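(* Let $X\subseteq\mathbb{R}^n$ be a smooth manifold and let $Y\subseteq\mathbb{R}^n$ be a closed definable subset. If the interval $[a,b]\subset\mathbb{R}$ contains no critical values of $\mathrm{dist}_Y|_X$, then the set $X_Y^b$ deformation retracts to the set $X_Y^a$.
   Context: "Definable" means definable in some o-minimal structure (for instance, the structure of globally subanalytic sets). $X\subseteq\mathbb{R}^n$ is regarded as a submanifold with the Riemannian metric induced from $\mathbb{R}^n$. For $z\in\mathbb{R}^n$, $\mathrm{dist}_Y(z)=\min_{y\in Y}\|y-z\|$ (Euclidean norm), $\mathrm{dist}_Y|_X\colon X\to\mathbb{R}$ is its restriction to $X$, and for $t\in\mathbb{R}$, $X_Y^t=\{x\in X\mid \mathrm{dist}_Y(x)\le t\}$. For a locally Lipschitz function $f\colon X\to\mathbb{R}$ let $\Omega(f)\subseteq X$ be the set of differentiability points; the (Clarke) subdifferential of $f$ at $x$ is $\partial_xf=\mathrm{co}\{\lim_{x_k\to x,\,x_k\in\Omega(f)}\nabla f(x_k)\mid \text{the limit exists}\}\subseteq T_xX$ (where $\mathrm{co}$ is the convex hull). A point $x\in X$ is critical for $f$ if $0\in\partial_xf$; $c\in\mathbb{R}$ is a critical value of $f$ if $f^{-1}(c)$ contains a critical point.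
   Formalization: The set of x in X with a ≤ dist_Y(x) ≤ b is assumed compact (automatic for compact X, or X closed and Y bounded), and Y nonempty; without compactness the claim fails, e.g. X=(1,2), Y={0}, [a,b]=[0,3]. *)

theory Defs
  imports "HOL-Analysis.Analysis"
begin

section \<open>Smooth submanifolds of Euclidean space\<close>

fun Ck_on :: "nat \<Rightarrow> ('a::euclidean_space \<Rightarrow> 'b::euclidean_space) \<Rightarrow> 'a set \<Rightarrow> bool" where
  "Ck_on 0 f U \<longleftrightarrow> continuous_on U f"
| "Ck_on (Suc k) f U \<longleftrightarrow>
     (\<forall>x\<in>U. f differentiable (at x)) \<and>
     (\<forall>v. Ck_on k (\<lambda>x. frechet_derivative f (at x) v) U)"

text \<open>Only meant for open \<open>U\<close>, since it uses unrestricted derivatives.\<close>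

definition smooth_on :: "'a set \<Rightarrow> ('a::euclidean_space \<Rightarrow> 'b::euclidean_space) \<Rightarrow> bool" where
  "smooth_on U f \<longleftrightarrow> (\<forall>k. Ck_on k f U)"

text \<open>
  Embedded submanifolds without boundary, described by local diffeomorphisms of the ambient
  space that flatten \<open>X\<close>. Neither compactness nor closedness nor connectedness is built in.
\<close>

definition smooth_submanifold_dim :: "nat \<Rightarrow> 'a::euclidean_space set \<Rightarrow> bool" where
  "smooth_submanifold_dim d X \<longleftrightarrow>
     (\<forall>p\<in>X. \<exists>U V \<phi> \<psi> L.
        open U \<and> p \<in> U \<and> open (V :: 'a set) \<and> homeomorphism U V \<phi> \<psi> \<and>
        smooth_on U \<phi> \<and> smooth_on V \<psi> \<and>
        subspace L \<and> dim L = d \<and> \<phi> ` (U \<inter> X) = V \<inter> L)"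

definition smooth_submanifold :: "'a::euclidean_space set \<Rightarrow> bool" where
  "smooth_submanifold X \<longleftrightarrow> (\<exists>d. smooth_submanifold_dim d X)"

definition tangent_space :: "'a::euclidean_space set \<Rightarrow> 'a \<Rightarrow> 'a set" where
  "tangent_space X p =
     {v. \<exists>\<gamma> e. 0 < e \<and> smooth_on {-e<..<e::real} \<gamma> \<and> \<gamma> ` {-e<..<e} \<subseteq> X \<and>
           \<gamma> 0 = p \<and> (\<gamma> has_vector_derivative v) (at 0)}"


section \<open>Clarke subdifferential and critical values\<close>

text \<open>
  The submanifold \<open>X\<close> carries the induced metric. A function is differentiable at \<open>x\<close> as a
  function on \<open>X\<close> (i.e. in charts) iff it has a derivative at \<open>x\<close> within \<open>X\<close>; such a derivative
  is determined only on the tangent space, and the Riemannian gradient is the tangent vector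
  representing it. The gradient is unique, so a relation is used instead of a choice.
\<close>

definition has_gradient_on ::
  "'a::euclidean_space set \<Rightarrow> ('a \<Rightarrow> real) \<Rightarrow> 'a \<Rightarrow> 'a \<Rightarrow> bool" where
  "has_gradient_on X f x v \<longleftrightarrow>
     x \<in> X \<and> v \<in> tangent_space X x \<and> (f has_derivative (\<lambda>h. v \<bullet> h)) (at x within X)"

definition clarke_subdifferential ::
  "'a::euclidean_space set \<Rightarrow> ('a \<Rightarrow> real) \<Rightarrow> 'a \<Rightarrow> 'a set" where
  "clarke_subdifferential X f x =
     convex hull {v. \<exists>xs gs. (\<forall>k::nat. has_gradient_on X f (xs k) (gs k)) \<and>
                       xs \<longlonglongrightarrow> x \<and> gs \<longlonglongrightarrow> v}"

definition critical_point :: "'a::euclidean_space set \<Rightarrow> ('a \<Rightarrow> real) \<Rightarrow> 'a \<Rightarrow> bool" where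
  "critical_point X f x \<longleftrightarrow> x \<in> X \<and> 0 \<in> clarke_subdifferential X f x"

definition critical_value :: "'a::euclidean_space set \<Rightarrow> ('a \<Rightarrow> real) \<Rightarrow> real \<Rightarrow> bool" where
  "critical_value X f c \<longleftrightarrow> (\<exists>x\<in>X. f x = c \<and> critical_point X f x)"

text \<open>For nonempty closed \<open>Y\<close> the infimum in \<^const>\<open>infdist\<close> is attained.\<close>

definition sublevel_dist ::
  "'a::euclidean_space set \<Rightarrow> 'a set \<Rightarrow> real \<Rightarrow> 'a set" where
  "sublevel_dist X Y t = {x\<in>X. infdist x Y \<le> t}"


section \<open>O-minimal structures\<close>

text \<open>
  O-minimal structures expanding the ordered field of real numbers. A point of the
  \<open>n\<close>-dimensional space is a list of length \<open>n\<close>, and \<open>S n\<close> is the family of definable subsets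
  of that space.
\<close>

definition o_minimal_structure :: "(nat \<Rightarrow> real list set set) \<Rightarrow> bool" where
  "o_minimal_structure S \<longleftrightarrow>
     (\<forall>n. \<forall>A\<in>S n. A \<subseteq> {xs. length xs = n}) \<and>
     (\<forall>n. {} \<in> S n) \<and>
     (\<forall>n. \<forall>A\<in>S n. \<forall>B\<in>S n. A \<union> B \<in> S n) \<and>
     (\<forall>n. \<forall>A\<in>S n. {xs. length xs = n} - A \<in> S n) \<and>
     (\<forall>n. \<forall>A\<in>S n. {x # xs | x xs. xs \<in> A} \<in> S (Suc n) \<and> {xs @ [x] | x xs. xs \<in> A} \<in> S (Suc n)) \<and>
     (\<forall>n. \<forall>A\<in>S (Suc n). butlast ` A \<in> S n) \<and>
     (\<forall>n. \<forall>i<n. \<forall>j<n. {xs. length xs = n \<and> xs ! i = xs ! j} \<in> S n) \<and>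
     {[x, y] | x y. x < y} \<in> S 2 \<and>
     {[x, y, x + y] | x y. True} \<in> S 3 \<and>
     {[x, y, x * y] | x y. True} \<in> S 3 \<and>
     S 1 = {(\<lambda>x. [x]) ` \<Union>F | F. finite F \<and> (\<forall>I\<in>F. is_interval I)}"

text \<open>
  The enumeration \<open>e\<close> of the coordinates is irrelevant, as each \<open>S n\<close> is closed under
  permutation of coordinates.
\<close>

definition definable :: "(real ^ 'n) set \<Rightarrow> bool" where
  "definable Y \<longleftrightarrow>
     (\<exists>S e. o_minimal_structure S \<and> bij_betw e {..<CARD('n)} (UNIV :: 'n set) \<and>
        (\<lambda>y. map (\<lambda>i. y $ e i) [0..<CARD('n)]) ` Y \<in> S CARD('n))"


section \<open>Deformation retracts\<close>

text \<open>The homotopy fixes \<open>A\<close> pointwise at all times (strong deformation retraction).\<close>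

definition deformation_retract_of ::
  "'a::topological_space set \<Rightarrow> 'a set \<Rightarrow> bool" where
  "deformation_retract_of A B \<longleftrightarrow>
     (\<exists>r. retraction B A r \<and> homotopic_with_canon (\<lambda>h. \<forall>x\<in>A. h x = x) B B id r)"

end

theory Submission
  imports Defs
begin

text \<open>
  Away from \<open>Y\<close> the distance function is touched from above by the smooth functions
  \<open>norm (x - y)\<close>, with \<open>y\<close> a nearest point. Hence it is differentiable wherever a quadratic touches
  it from below, so on a dense subset of \<open>X\<close>, and at such points its linear approximation is an
  upper bound with a locally uniform error. At a noncritical point the limiting gradients have a common ascent
  direction \<open>a\<close>; moving in a chart along the fixed direction corresponding to \<open>-a\<close> therefore
  decreases the distance at a definite rate, first from points of differentiability, then by density
  from all nearby points. The same estimate shows that points of \<open>X \<inter> Y\<close> are critical. Neither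
  Rademacher's theorem nor the flow of a vector field is needed: the local straight-line descents,
  reparametrised by the value of the distance, are composed with cut-offs over a finite cover of
  the compact slab \<open>a \<le> dist \<le> b\<close>, and this lowers the slab by a uniform amount, finitely often.
\<close>

section \<open>Deformation retractions from local descents\<close>

text \<open>Two obstacles shape the argument. The Clarke subdifferential sees only points of
  differentiability, so noncriticality says nothing useful until such points are known to be dense
  in \<open>X\<close> off \<open>Y\<close>. And the linear upper bound at such a point has error
  \<open>(norm q)\<^sup>2 / norm p\<close>, where \<open>norm p\<close> is the distance itself, so
  it is uniform only away from \<open>Y\<close>. The direction and the rate of descent, however, do
  not deteriorate near \<open>Y\<close>, and this is what excludes noncritical points in
  \<open>X \<inter> Y\<close>. Local descents are normalised to lower \<open>f\<close> by exactly
  the elapsed time. Drops then add up wherever a composition has carried the point, and a point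
  above a level can be stopped exactly on it, which makes the end map a retraction.\<close>

lemma deformation_retract_of_refl: "deformation_retract_of A A"
  unfolding deformation_retract_of_def
  by (intro exI[of _ id]) (auto simp: retraction_def)

text \<open>The homotopy of \<open>B\<close> is run after \<open>r2\<close>, as its precomposition
  with \<open>r2\<close>; both halves fix \<open>A\<close> because \<open>r2\<close> fixes
  \<open>B\<close>, which contains \<open>A\<close>.\<close>

lemma deformation_retract_of_trans:
  assumes "deformation_retract_of A B" "deformation_retract_of B C"
  shows "deformation_retract_of A C"
proof -
  obtain r1 where r1: "retraction B A r1"
    and h1: "homotopic_with_canon (\<lambda>h. \<forall>x\<in>A. h x = x) B B id r1"
    using assms(1) unfolding deformation_retract_of_def by blast
  obtain r2 where r2: "retraction C B r2"
    and h2: "homotopic_with_canon (\<lambda>h. \<forall>x\<in>B. h x = x) C C id r2"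
    using assms(2) unfolding deformation_retract_of_def by blast
  have AB: "A \<subseteq> B" and BC: "B \<subseteq> C" using r1 r2 by (auto simp: retraction_def)
  have r2': "continuous_on C r2" "r2 \<in> C \<rightarrow> B" "\<And>x. x \<in> A \<Longrightarrow> r2 x = x"
    using r2 AB by (auto simp: retraction_def)
  have "homotopic_with_canon (\<lambda>h. \<forall>x\<in>A. h x = x) C B (id \<circ> r2) (r1 \<circ> r2)"
    by (rule homotopic_with_compose_continuous_right[OF _ r2'(1,2)])
      (rule homotopic_with_mono[OF h1], use r2'(3) in auto)
  then have "homotopic_with_canon (\<lambda>h. \<forall>x\<in>A. h x = x) C C (id \<circ> r2) (r1 \<circ> r2)"
    by (rule homotopic_with_subset_right[OF _ BC])
  moreover have "homotopic_with_canon (\<lambda>h. \<forall>x\<in>A. h x = x) C C id r2"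
    by (rule homotopic_with_mono[OF h2]) (use AB in auto)
  ultimately have "homotopic_with_canon (\<lambda>h. \<forall>x\<in>A. h x = x) C C id (r1 \<circ> r2)"
    by (auto intro: homotopic_with_trans)
  moreover have "retraction C A (r1 \<circ> r2)"
    using retraction_comp[OF r2 r1] .
  ultimately show ?thesis unfolding deformation_retract_of_def by blast
qed

text \<open>The amounts \<open>\<rho>\<close> by which the finitely many local descents are slowed down are evaluated
  at the starting point, so that the total descent is exactly the sum of the local ones.\<close>

lemma compose_local_descents:
  fixes f :: "'a::metric_space \<Rightarrow> real" and r e :: "'a \<Rightarrow> real" and P :: "'a \<Rightarrow> 'a \<times> real \<Rightarrow> 'a"
  assumes "compact K" "K \<subseteq> X" "finite F"
    and r: "\<And>p. p \<in> F \<Longrightarrow> 0 < r p" and e: "\<And>p. p \<in> F \<Longrightarrow> 0 < e p"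
    and P: "\<And>p. p \<in> F \<Longrightarrow> continuous_on ((ball p (r p) \<inter> X) \<times> {0..e p}) (P p)"
    and P0: "\<And>p z. p \<in> F \<Longrightarrow> z \<in> ball p (r p) \<inter> X \<Longrightarrow> P p (z, 0) = z"
    and PX: "\<And>p z s. p \<in> F \<Longrightarrow> z \<in> ball p (r p) \<inter> X \<Longrightarrow> s \<in> {0..e p} \<Longrightarrow> P p (z, s) \<in> X"
    and Pf: "\<And>p z s. p \<in> F \<Longrightarrow> z \<in> ball p (r p) \<inter> X \<Longrightarrow> s \<in> {0..e p} \<Longrightarrow> f (P p (z, s)) = f z - s"
  shows "\<exists>\<eta>>0. \<exists>H. continuous_on (K \<times> {0..\<eta>}) H \<and>
    (\<forall>x\<in>K. H (x, 0) = x \<and>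
      (\<forall>s\<in>{0..\<eta>}. H (x, s) \<in> X \<and> f (H (x, s)) = f x - s * (\<Sum>p\<in>F. max 0 (r p / 2 - dist x p))))"
  using \<open>finite F\<close> r e P P0 PX Pf
proof (induction F)
  case empty
  show ?case
    by (intro exI[of _ 1] conjI exI[of _ fst]) (use \<open>K \<subseteq> X\<close> in \<open>auto intro: continuous_on_fst continuous_on_id\<close>)
next
  case (insert p F)
  let ?\<rho> = "\<lambda>q x. max 0 (r q / 2 - dist x q)"
  obtain \<eta> H where \<eta>: "0 < \<eta>" and Hc: "continuous_on (K \<times> {0..\<eta>}) H"
    and H: "\<And>x. x \<in> K \<Longrightarrow> H (x, 0) = x"
    "\<And>x s. x \<in> K \<Longrightarrow> s \<in> {0..\<eta>} \<Longrightarrow> H (x, s) \<in> X"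
    "\<And>x s. x \<in> K \<Longrightarrow> s \<in> {0..\<eta>} \<Longrightarrow> f (H (x, s)) = f x - s * (\<Sum>q\<in>F. ?\<rho> q x)"
  proof -
    have "\<exists>\<eta>>0. \<exists>H. continuous_on (K \<times> {0..\<eta>}) H \<and> (\<forall>x\<in>K. H (x, 0) = x \<and>
      (\<forall>s\<in>{0..\<eta>}. H (x, s) \<in> X \<and> f (H (x, s)) = f x - s * (\<Sum>q\<in>F. ?\<rho> q x)))"
      using insert.prems by (intro insert.IH) auto
    then show ?thesis using that by blast
  qed
  have rp: "0 < r p" and ep: "0 < e p" using insert.prems by auto
  have "uniformly_continuous_on (K \<times> {0..\<eta>}) H"
    using compact_uniformly_continuous[OF Hc] compact_Times[OF \<open>compact K\<close>] by blast
  then obtain d where d: "0 < d" "\<And>x y. x \<in> K \<times> {0..\<eta>} \<Longrightarrow> y \<in> K \<times> {0..\<eta>} \<Longrightarrow> dist y x < d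
      \<Longrightarrow> dist (H y) (H x) < r p / 2"
    unfolding uniformly_continuous_on_def using rp by (metis half_gt_zero)
  \<comment> \<open>\<open>d/2\<close> keeps \<open>H (x, s)\<close> within \<open>r p / 2\<close>
    of \<open>x\<close>, hence in the ball of radius \<open>r p\<close> when \<open>x\<close> is in
    the half ball. \<open>e p / r p\<close> keeps the slowed time \<open>s * ?\<rho> p x\<close> in
    the domain of \<open>P p\<close>, since the cut-off never exceeds \<open>r p\<close>.\<close>
  define \<eta>' where "\<eta>' = min \<eta> (min (d/2) (e p / r p))"
  have \<eta>': "0 < \<eta>'" "\<eta>' \<le> \<eta>" "\<eta>' < d" "\<eta>' * r p \<le> e p"
  proof -
    have "\<eta>' * r p \<le> e p / r p * r p"
      using rp by (intro mult_right_mono) (auto simp: \<eta>'_def)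
    then show "\<eta>' * r p \<le> e p" using rp by simp
  qed (use \<eta> d(1) rp ep in \<open>auto simp: \<eta>'_def\<close>)
  have inball: "H (x, s) \<in> ball p (r p) \<inter> X" if "x \<in> K" "dist x p \<le> r p / 2" "s \<in> {0..\<eta>'}" for x s
  proof -
    have "dist (H (x, s)) (H (x, 0)) < r p / 2"
      using that \<eta>' by (intro d(2)) (auto simp: dist_Pair_Pair)
    then have "dist p (H (x, s)) < r p"
      using that H(1)[of x] dist_triangle2[of p "H (x, s)" x] by (auto simp: dist_commute)
    then show ?thesis using that \<eta>' H(2)[of x s] by auto
  qed
  have scaled: "s * ?\<rho> p x \<in> {0..e p}" if "s \<in> {0..\<eta>'}" for x s
  proof -
    have "s * ?\<rho> p x \<le> \<eta>' * r p"
      using that rp \<eta>' zero_le_dist[of x p] by (intro mult_mono) (auto simp del: zero_le_dist)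
    then show ?thesis using that \<eta>'(4) by auto
  qed
  \<comment> \<open>\<open>P p\<close> acts only over the half ball; on its boundary the cut-off is
    0 and \<open>P p (_, 0)\<close> is the identity, so the two branches agree there.\<close>
  define H' where "H' = (\<lambda>z. if dist (fst z) p \<le> r p / 2
      then P p (H z, snd z * ?\<rho> p (fst z)) else H z)"
  have "continuous_on (K \<times> {0..\<eta>'}) H'"
    unfolding H'_def
  proof (rule continuous_on_cases_le)
    let ?S = "{x \<in> K \<times> {0..\<eta>'}. dist (fst x) p \<le> r p / 2}"
    have "continuous_on ?S (\<lambda>z. (H z, snd z * ?\<rho> p (fst z)))"
      using \<eta>' by (intro continuous_intros continuous_on_subset[OF Hc]) auto
    moreover have "(H z, snd z * ?\<rho> p (fst z)) \<in> (ball p (r p) \<inter> X) \<times> {0..e p}" if "z \<in> ?S" for z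
      using that inball[of "fst z" "snd z"] scaled[of "snd z" "fst z"] by (cases z) auto
    ultimately have "continuous_on ?S (P p \<circ> (\<lambda>z. (H z, snd z * ?\<rho> p (fst z))))"
      using insert.prems(3)[of p] by (intro continuous_on_compose) (auto elim!: continuous_on_subset)
    then show "continuous_on ?S (\<lambda>z. P p (H z, snd z * ?\<rho> p (fst z)))" by (simp add: o_def)
    show "continuous_on {x \<in> K \<times> {0..\<eta>'}. r p / 2 \<le> dist (fst x) p} H"
      using \<eta>' by (intro continuous_on_subset[OF Hc]) auto
    show "P p (H x, snd x * ?\<rho> p (fst x)) = H x"
      if "x \<in> K \<times> {0..\<eta>'}" "dist (fst x) p = r p / 2" for x
      using that insert.prems(4)[of p "H x"] inball[of "fst x" "snd x"] by auto
  qed (intro continuous_intros)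
  moreover have "H' (x, 0) = x" if "x \<in> K" for x
    using that insert.prems(4)[of p x] inball[of x 0] H(1) \<eta>' by (auto simp: H'_def)
  moreover have "H' (x, s) \<in> X" if "x \<in> K" "s \<in> {0..\<eta>'}" for x s
    using that inball[of x s] scaled[of s x] insert.prems(5)[of p "H (x, s)"] H(2)[of x s] \<eta>'
    by (auto simp: H'_def)
  moreover have "f (H' (x, s)) = f x - s * (\<Sum>q\<in>insert p F. ?\<rho> q x)"
    if "x \<in> K" "s \<in> {0..\<eta>'}" for x s
  proof (cases "dist x p \<le> r p / 2")
    case True
    then have "f (H' (x, s)) = f (H (x, s)) - s * ?\<rho> p x"
      using that inball[of x s] scaled[of s x] insert.prems(6)[of p "H (x, s)"] by (simp add: H'_def)
    then show ?thesis using that H(3)[of x s] \<eta>' insert.hyps by (simp add: algebra_simps)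
  next
    case False
    then show ?thesis using that H(3)[of x s] \<eta>' insert.hyps by (simp add: H'_def)
  qed
  ultimately show ?case using \<eta>'(1) by blast
qed

text \<open>Dividing the time by the sum of the cut-offs turns a descent of variable speed into one
  of speed 1. The sum is positive because the half balls cover \<open>K\<close>, and its minimum
  over \<open>K\<close> decides how long the rescaled descent can run.\<close>

lemma uniform_descent:
  fixes f :: "'a::metric_space \<Rightarrow> real"
  assumes K: "compact K" "K \<subseteq> X"
    and local: "\<And>p. p \<in> K \<Longrightarrow> \<exists>r>0. \<exists>e>0. \<exists>P. continuous_on ((ball p r \<inter> X) \<times> {0..e}) P \<and>
      (\<forall>z\<in>ball p r \<inter> X. P (z, 0) = z \<and> (\<forall>s\<in>{0..e}. P (z, s) \<in> X \<and> f (P (z, s)) = f z - s))"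
  obtains \<eta> H where "0 < \<eta>" "continuous_on (K \<times> {0..\<eta>}) H" "\<And>x. x \<in> K \<Longrightarrow> H (x, 0) = x"
    "\<And>x s. x \<in> K \<Longrightarrow> s \<in> {0..\<eta>} \<Longrightarrow> H (x, s) \<in> X"
    "\<And>x s. x \<in> K \<Longrightarrow> s \<in> {0..\<eta>} \<Longrightarrow> f (H (x, s)) = f x - s"
proof (cases "K = {}")
  case True
  then show ?thesis by (intro that[of 1 fst]) auto
next
  case False
  have "\<forall>p\<in>K. \<exists>r e P. 0 < r \<and> 0 < e \<and> continuous_on ((ball p r \<inter> X) \<times> {0..e}) P \<and>
      (\<forall>z\<in>ball p r \<inter> X. P (z, 0) = z \<and> (\<forall>s\<in>{0..e}. P (z, s) \<in> X \<and> f (P (z, s)) = f z - s))"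
    using local by (intro ballI) blast
  from this[unfolded bchoice_iff] obtain r e P where rP: "\<And>p. p \<in> K \<Longrightarrow> 0 < r p \<and> 0 < e p \<and>
      continuous_on ((ball p (r p) \<inter> X) \<times> {0..e p}) (P p) \<and>
      (\<forall>z\<in>ball p (r p) \<inter> X. P p (z, 0) = z \<and>
        (\<forall>s\<in>{0..e p}. P p (z, s) \<in> X \<and> f (P p (z, s)) = f z - s))"
    by blast
  obtain F where F: "F \<subseteq> K" "finite F" "K \<subseteq> (\<Union>p\<in>F. ball p (r p / 2))"
  proof (rule compactE_image[OF K(1), of K "\<lambda>p. ball p (r p / 2)"])
    show "K \<subseteq> (\<Union>p\<in>K. ball p (r p / 2))"
      using rP by (force intro: centre_in_ball[THEN iffD2])
  qed auto
  have sub: "p \<in> K" if "p \<in> F" for p using that F by auto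
  define \<sigma> where "\<sigma> = (\<lambda>x. \<Sum>p\<in>F. max 0 (r p / 2 - dist x p))"
  have "\<exists>\<eta>>0. \<exists>H. continuous_on (K \<times> {0..\<eta>}) H \<and>
    (\<forall>x\<in>K. H (x, 0) = x \<and>
      (\<forall>s\<in>{0..\<eta>}. H (x, s) \<in> X \<and> f (H (x, s)) = f x - s * (\<Sum>p\<in>F. max 0 (r p / 2 - dist x p))))"
    by (rule compose_local_descents[OF K F(2), of r e P]) (use rP[OF sub] in blast)+
  then obtain \<eta> H where \<eta>: "0 < \<eta>" and Hc: "continuous_on (K \<times> {0..\<eta>}) H"
    and H: "\<And>x. x \<in> K \<Longrightarrow> H (x, 0) = x"
    "\<And>x s. x \<in> K \<Longrightarrow> s \<in> {0..\<eta>} \<Longrightarrow> H (x, s) \<in> X"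
    "\<And>x s. x \<in> K \<Longrightarrow> s \<in> {0..\<eta>} \<Longrightarrow> f (H (x, s)) = f x - s * \<sigma> x"
    unfolding \<sigma>_def by auto
  have \<sigma>c: "continuous_on K \<sigma>" unfolding \<sigma>_def by (intro continuous_intros)
  obtain x0 where x0: "x0 \<in> K" "\<And>x. x \<in> K \<Longrightarrow> \<sigma> x0 \<le> \<sigma> x"
    using continuous_attains_inf[OF K(1) False \<sigma>c] by blast
  have "0 < \<sigma> x0"
  proof -
    obtain p where "p \<in> F" "dist x0 p < r p / 2" using F(3) x0(1) by (auto simp: dist_commute)
    then have "0 < max 0 (r p / 2 - dist x0 p)" by simp
    also have "\<dots> \<le> \<sigma> x0"
      unfolding \<sigma>_def by (rule member_le_sum[OF \<open>p \<in> F\<close> _ F(2)]) auto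
    finally show ?thesis .
  qed
  then have \<sigma>p: "0 < \<sigma> x" if "x \<in> K" for x using x0(2)[OF that] by simp
  have quot: "t / \<sigma> x \<in> {0..\<eta>}" if "x \<in> K" "t \<in> {0..\<eta> * \<sigma> x0}" for x t
  proof -
    have "t \<le> \<eta> * \<sigma> x"
      using that x0(2)[OF that(1)] \<eta> by (meson atLeastAtMost_iff mult_left_mono less_imp_le order_trans)
    then show ?thesis using \<sigma>p[OF that(1)] that by (auto simp: field_simps)
  qed
  show ?thesis
  proof (rule that[of "\<eta> * \<sigma> x0" "\<lambda>z. H (fst z, snd z / \<sigma> (fst z))"])
    show "0 < \<eta> * \<sigma> x0" using \<eta> \<open>0 < \<sigma> x0\<close> by simp
    have "continuous_on (K \<times> {0..\<eta> * \<sigma> x0}) (\<lambda>z. (fst z, snd z / \<sigma> (fst z)))"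
      by (intro continuous_intros continuous_on_compose2[OF \<sigma>c]) (use \<sigma>p in force)+
    then have "continuous_on (K \<times> {0..\<eta> * \<sigma> x0}) (H \<circ> (\<lambda>z. (fst z, snd z / \<sigma> (fst z))))"
      by (rule continuous_on_compose) (rule continuous_on_subset[OF Hc], use quot in force)
    then show "continuous_on (K \<times> {0..\<eta> * \<sigma> x0}) (\<lambda>z. H (fst z, snd z / \<sigma> (fst z)))"
      by (simp add: o_def)
  next
    fix x s assume xs: "x \<in> K" "s \<in> {0..\<eta> * \<sigma> x0}"
    show "H (fst (x, s), snd (x, s) / \<sigma> (fst (x, s))) \<in> X"
      using H(2)[OF xs(1) quot[OF xs]] by simp
    show "f (H (fst (x, s), snd (x, s) / \<sigma> (fst (x, s)))) = f x - s"
      using H(3)[OF xs(1) quot[OF xs]] \<sigma>p[OF xs(1)] by simp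
  qed (use H in auto)
qed

text \<open>A point above the level \<open>c\<close> is moved for the time \<open>f x - c\<close>,
  its excess height, so it ends exactly on that level; points below rest. The bound
  \<open>d - c \<le> \<eta>\<close> makes this time admissible.\<close>

lemma deformation_retract_of_short_descent:
  fixes f :: "'a::metric_space \<Rightarrow> real"
  assumes f: "continuous_on X f" and ac: "a \<le> c" "c \<le> d" "d \<le> b" "d - c \<le> \<eta>"
    and Hc: "continuous_on ({x\<in>X. a \<le> f x \<and> f x \<le> b} \<times> {0..\<eta>}) H"
    and H0: "\<And>x. x \<in> X \<Longrightarrow> a \<le> f x \<Longrightarrow> f x \<le> b \<Longrightarrow> H (x, 0) = x"
    and HX: "\<And>x s. x \<in> X \<Longrightarrow> a \<le> f x \<Longrightarrow> f x \<le> b \<Longrightarrow> s \<in> {0..\<eta>} \<Longrightarrow> H (x, s) \<in> X"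
    and Hf: "\<And>x s. x \<in> X \<Longrightarrow> a \<le> f x \<Longrightarrow> f x \<le> b \<Longrightarrow> s \<in> {0..\<eta>} \<Longrightarrow> f (H (x, s)) = f x - s"
  shows "deformation_retract_of {x\<in>X. f x \<le> c} {x\<in>X. f x \<le> d}"
proof -
  let ?A = "{x\<in>X. f x \<le> c}" and ?B = "{x\<in>X. f x \<le> d}"
  define G where "G = (\<lambda>z. if f (snd z) \<le> c then snd z else H (snd z, fst z * (f (snd z) - c)))"
  have fB: "continuous_on ({0..1::real} \<times> ?B) (\<lambda>z. f (snd z))"
    by (intro continuous_on_compose2[OF f] continuous_intros) auto
  have rng: "t * (f x - c) \<in> {0..\<eta>}" if "t \<in> {0..1}" "f x \<le> d" "c \<le> f x" for t x
  proof -
    have "t * (f x - c) \<le> 1 * (f x - c)" using that by (intro mult_right_mono) auto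
    then show ?thesis using that ac by auto
  qed
  have Gc: "continuous_on ({0..1::real} \<times> ?B) G"
    unfolding G_def
  proof (rule continuous_on_cases_le[OF _ _ fB])
    let ?S = "{x \<in> {0..1::real} \<times> ?B. c \<le> f (snd x)}"
    have "continuous_on ?S (\<lambda>z. (snd z, fst z * (f (snd z) - c)))"
      by (intro continuous_intros continuous_on_subset[OF fB]) auto
    then have "continuous_on ?S (H \<circ> (\<lambda>z. (snd z, fst z * (f (snd z) - c))))"
      by (rule continuous_on_compose) (rule continuous_on_subset[OF Hc], use rng ac in force)
    then show "continuous_on ?S (\<lambda>z. H (snd z, fst z * (f (snd z) - c)))" by (simp add: o_def)
    show "snd x = H (snd x, fst x * (f (snd x) - c))" if "x \<in> {0..1::real} \<times> ?B" "f (snd x) = c" for x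
      using that H0[of "snd x"] ac by auto
  qed (intro continuous_intros)
  have GX: "G (t, x) \<in> X \<and> f (G (t, x)) = (if f x \<le> c then f x else f x - t * (f x - c))"
    if "t \<in> {0..1}" "x \<in> ?B" for t x
    using that rng[of t x] HX[of x "t * (f x - c)"] Hf[of x "t * (f x - c)"] ac by (auto simp: G_def)
  have GB: "G (t, x) \<in> ?B" if "t \<in> {0..1}" "x \<in> ?B" for t x
  proof (cases "f x \<le> c")
    case False
    then have "0 \<le> t * (f x - c)" "f x \<le> d" "x \<in> X" using that by auto
    then show ?thesis using GX[OF that] False by simp
  qed (use GX[OF that] that in auto)
  have G1: "G (1, x) \<in> ?A" if "x \<in> ?B" for x
    using GX[of 1 x] that by (cases "f x \<le> c") auto
  have "retraction ?B ?A (\<lambda>x. G (1, x))"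
    unfolding retraction_def
  proof (intro conjI)
    show "continuous_on ?B (\<lambda>x. G (1, x))"
      by (rule continuous_on_compose2[OF Gc, of _ "\<lambda>x. (1, x)"]) (auto intro!: continuous_intros)
  qed (use ac G1 in \<open>auto simp: G_def\<close>)
  moreover have "homotopic_with_canon (\<lambda>h. \<forall>x\<in>?A. h x = x) ?B ?B id (\<lambda>x. G (1, x))"
  proof (subst homotopic_with, goal_cases)
    case 2
    show ?case
      using Gc GB H0 ac by (intro exI[of _ G]) (auto simp: Pi_iff G_def)
  qed (use ac in auto)
  ultimately show ?thesis unfolding deformation_retract_of_def by blast
qed

lemma deformation_retract_of_sublevel:
  fixes f :: "'a::metric_space \<Rightarrow> real"
  assumes f: "continuous_on X f" and "a \<le> b" and K: "compact {x\<in>X. a \<le> f x \<and> f x \<le> b}"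
    and local: "\<And>p. p \<in> X \<Longrightarrow> a \<le> f p \<Longrightarrow> f p \<le> b \<Longrightarrow>
      \<exists>r>0. \<exists>e>0. \<exists>P. continuous_on ((ball p r \<inter> X) \<times> {0..e}) P \<and>
        (\<forall>z\<in>ball p r \<inter> X. P (z, 0) = z \<and> (\<forall>s\<in>{0..e}. P (z, s) \<in> X \<and> f (P (z, s)) = f z - s))"
  shows "deformation_retract_of {x\<in>X. f x \<le> a} {x\<in>X. f x \<le> b}"
proof -
  obtain \<eta> H where \<eta>: "0 < \<eta>"
    and H: "continuous_on ({x\<in>X. a \<le> f x \<and> f x \<le> b} \<times> {0..\<eta>}) H"
    "\<And>x. x \<in> {x\<in>X. a \<le> f x \<and> f x \<le> b} \<Longrightarrow> H (x, 0) = x"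
    "\<And>x s. x \<in> {x\<in>X. a \<le> f x \<and> f x \<le> b} \<Longrightarrow> s \<in> {0..\<eta>} \<Longrightarrow> H (x, s) \<in> X"
    "\<And>x s. x \<in> {x\<in>X. a \<le> f x \<and> f x \<le> b} \<Longrightarrow> s \<in> {0..\<eta>} \<Longrightarrow> f (H (x, s)) = f x - s"
  proof (rule uniform_descent[OF K, of X f])
    fix p assume "p \<in> {x\<in>X. a \<le> f x \<and> f x \<le> b}"
    then show "\<exists>r>0. \<exists>e>0. \<exists>P. continuous_on ((ball p r \<inter> X) \<times> {0..e}) P \<and>
        (\<forall>z\<in>ball p r \<inter> X. P (z, 0) = z \<and> (\<forall>s\<in>{0..e}. P (z, s) \<in> X \<and> f (P (z, s)) = f z - s))"
      by (intro local) auto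
  qed (fast, rule that)
  have step: "deformation_retract_of {x\<in>X. f x \<le> c} {x\<in>X. f x \<le> d}"
    if "a \<le> c" "c \<le> d" "d \<le> b" "d - c \<le> \<eta>" for c d
    using H by (intro deformation_retract_of_short_descent[OF f that, of H]) auto
  have "deformation_retract_of {x\<in>X. f x \<le> a} {x\<in>X. f x \<le> d}"
    if "a \<le> d" "d \<le> b" "d - a \<le> real n * \<eta>" for n d
    using that
  proof (induction n arbitrary: d)
    case 0
    then have "d = a" by simp
    then show ?case by (simp add: deformation_retract_of_refl)
  next
    case (Suc n)
    \<comment> \<open>The truncation at \<open>a\<close> keeps the lowest step inside the slab,
      where \<open>H\<close> is defined.\<close>
    let ?c = "max a (d - \<eta>)"
    have "deformation_retract_of {x\<in>X. f x \<le> a} {x\<in>X. f x \<le> ?c}"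
      using Suc.prems \<eta> by (intro Suc.IH) (auto simp: algebra_simps)
    moreover have "deformation_retract_of {x\<in>X. f x \<le> ?c} {x\<in>X. f x \<le> d}"
      using Suc.prems \<eta> by (intro step) auto
    ultimately show ?case by (rule deformation_retract_of_trans)
  qed
  moreover obtain n where "b - a \<le> real n * \<eta>"
    using \<eta> by (meson ex_less_of_nat_mult less_imp_le)
  ultimately show ?thesis using \<open>a \<le> b\<close> by blast
qed

section \<open>Slice charts of a submanifold\<close>

lemma Ck_on_cong:
  assumes "open U" "\<And>x. x \<in> U \<Longrightarrow> f x = g x"
  shows "Ck_on k f U \<longleftrightarrow> Ck_on k g U"
  using assms(2)
proof (induction k arbitrary: f g)
  case 0
  then show ?case by (simp cong: continuous_on_cong)
next
  case (Suc k)
  have der: "(f has_derivative D) (at x) \<longleftrightarrow> (g has_derivative D) (at x)" if "x \<in> U" for x D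
    using has_derivative_transform_within_open[OF _ \<open>open U\<close> that] Suc.prems by metis
  then have "frechet_derivative f (at x) = frechet_derivative g (at x)" if "x \<in> U" for x
    using that by (simp add: frechet_derivative_def)
  moreover have "f differentiable (at x) \<longleftrightarrow> g differentiable (at x)" if "x \<in> U" for x
    using der that by (simp add: differentiable_def)
  ultimately show ?case by (simp cong: Suc.IH)
qed

text \<open>The derivative along the line is the map
  \<open>x \<mapsto> frechet_derivative f (at x) (v *\<^sub>R l)\<close> restricted to the same
  line, so the induction closes once \<open>f\<close> is arbitrary. The lemma makes straight chart
  lines smooth curves in \<open>X\<close>.\<close>

lemma Ck_on_compose_line:
  fixes f :: "'a::euclidean_space \<Rightarrow> 'b::euclidean_space"
  assumes "open I" "\<And>t. t \<in> I \<Longrightarrow> u + t *\<^sub>R l \<in> U" "Ck_on k f U"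
  shows "Ck_on k (\<lambda>t::real. f (u + t *\<^sub>R l)) I"
  using assms(3)
proof (induction k arbitrary: f)
  case 0
  then show ?case
    using assms(2) by (auto intro!: continuous_on_compose2[of U f] continuous_intros)
next
  case (Suc k)
  have D: "((\<lambda>t. f (u + t *\<^sub>R l)) has_derivative
      (\<lambda>s. frechet_derivative f (at (u + t *\<^sub>R l)) (s *\<^sub>R l))) (at t)" if "t \<in> I" for t
  proof -
    have "f differentiable at (u + t *\<^sub>R l)" using Suc.prems assms(2)[OF that] by simp
    then have "(f has_derivative frechet_derivative f (at (u + t *\<^sub>R l))) (at (u + t *\<^sub>R l))"
      by (simp add: frechet_derivative_works)
    then show ?thesis
      by (rule has_derivative_compose[rotated]) (auto intro!: derivative_eq_intros)
  qed
  have "Ck_on k (\<lambda>t. frechet_derivative (\<lambda>t. f (u + t *\<^sub>R l)) (at t) v) I" for v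
  proof -
    have "Ck_on k (\<lambda>x. frechet_derivative f (at x) (v *\<^sub>R l)) U" using Suc.prems by simp
    then have "Ck_on k (\<lambda>t. frechet_derivative f (at (u + t *\<^sub>R l)) (v *\<^sub>R l)) I" by (rule Suc.IH)
    then show ?thesis
      by (rule Ck_on_cong[OF \<open>open I\<close>, THEN iffD1, rotated])
        (use fun_cong[OF frechet_derivative_at[OF D]] in force)
  qed
  then show ?case using D by (auto simp: differentiable_def)
qed

lemma smooth_on_has_derivative:
  assumes "smooth_on U f" "x \<in> U"
  shows "(f has_derivative frechet_derivative f (at x)) (at x)"
proof -
  have "Ck_on (Suc 0) f U" using assms unfolding smooth_on_def by blast
  then show ?thesis using assms(2) by (simp add: frechet_derivative_works)
qed

lemma smooth_on_continuous_derivative: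
  assumes "smooth_on U f"
  shows "continuous_on U (\<lambda>x. frechet_derivative f (at x) v)"
proof -
  have "Ck_on (Suc 0) f U" using assms unfolding smooth_on_def by blast
  then show ?thesis by simp
qed

section \<open>Charts, their derivatives and the tangent space\<close>

locale slice_chart =
  fixes X U V L :: "'a::euclidean_space set" and \<phi> \<psi> :: "'a \<Rightarrow> 'a"
  assumes openU: "open U" and openV: "open V" and homeo: "homeomorphism U V \<phi> \<psi>"
    and smooth_\<phi>: "smooth_on U \<phi>" and smooth_\<psi>: "smooth_on V \<psi>"
    and subspaceL: "subspace L" and slice: "\<phi> ` (U \<inter> X) = V \<inter> L"
begin

abbreviation D\<phi> where "D\<phi> x \<equiv> frechet_derivative \<phi> (at x)"
abbreviation D\<psi> where "D\<psi> u \<equiv> frechet_derivative \<psi> (at u)"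

lemma \<phi>_\<psi>: "u \<in> V \<Longrightarrow> \<psi> u \<in> U \<and> \<phi> (\<psi> u) = u"
  using homeo unfolding homeomorphism_def by blast

lemma \<psi>_\<phi>: "x \<in> U \<Longrightarrow> \<phi> x \<in> V \<and> \<psi> (\<phi> x) = x"
  using homeo unfolding homeomorphism_def by blast

lemma continuous_\<psi>: "continuous_on V \<psi>" and continuous_\<phi>: "continuous_on U \<phi>"
  using homeo unfolding homeomorphism_def by blast+

lemma \<psi>_in_X: "u \<in> V \<Longrightarrow> u \<in> L \<Longrightarrow> \<psi> u \<in> X"
  using slice \<psi>_\<phi> by (metis IntI IntE imageE)

lemma \<phi>_in_L: "x \<in> U \<Longrightarrow> x \<in> X \<Longrightarrow> \<phi> x \<in> L"
  using slice by blast

lemma has_derivative_\<psi>: "u \<in> V \<Longrightarrow> (\<psi> has_derivative D\<psi> u) (at u)"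
  using smooth_on_has_derivative[OF smooth_\<psi>] .

lemma has_derivative_\<phi>: "x \<in> U \<Longrightarrow> (\<phi> has_derivative D\<phi> x) (at x)"
  using smooth_on_has_derivative[OF smooth_\<phi>] .

lemma D\<psi>_D\<phi>: assumes "u \<in> V" shows "D\<psi> u (D\<phi> (\<psi> u) v) = v"
proof -
  have "((\<lambda>x. \<psi> (\<phi> x)) has_derivative (\<lambda>v. D\<psi> u (D\<phi> (\<psi> u) v))) (at (\<psi> u))"
    using has_derivative_compose[OF has_derivative_\<phi>, of "\<psi> u" \<psi> "D\<psi> u"] has_derivative_\<psi>[of u]
      \<phi>_\<psi>[of u] assms by auto
  then have "((\<lambda>x. x) has_derivative (\<lambda>v. D\<psi> u (D\<phi> (\<psi> u) v))) (at (\<psi> u))"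
    by (rule has_derivative_transform_within_open[OF _ openU]) (use \<phi>_\<psi> \<psi>_\<phi> assms in auto)
  then have "(\<lambda>v. D\<psi> u (D\<phi> (\<psi> u) v)) = (\<lambda>v. v)"
    using has_derivative_unique has_derivative_ident by blast
  then show ?thesis by meson
qed

lemma D\<phi>_D\<psi>: assumes "u \<in> V" shows "D\<phi> (\<psi> u) (D\<psi> u v) = v"
proof -
  have "((\<lambda>x. \<phi> (\<psi> x)) has_derivative (\<lambda>v. D\<phi> (\<psi> u) (D\<psi> u v))) (at u)"
    using has_derivative_compose[OF has_derivative_\<psi>, of u \<phi> "D\<phi> (\<psi> u)"] has_derivative_\<phi>[of "\<psi> u"]
      \<phi>_\<psi>[of u] assms by auto
  then have "((\<lambda>x. x) has_derivative (\<lambda>v. D\<phi> (\<psi> u) (D\<psi> u v))) (at u)"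
    by (rule has_derivative_transform_within_open[OF _ openV]) (use \<phi>_\<psi> \<psi>_\<phi> assms in auto)
  then have "(\<lambda>v. D\<phi> (\<psi> u) (D\<psi> u v)) = (\<lambda>v. v)"
    using has_derivative_unique has_derivative_ident by blast
  then show ?thesis by meson
qed

lemma linear_D\<psi>: "u \<in> V \<Longrightarrow> linear (D\<psi> u)"
  using has_derivative_\<psi> has_derivative_linear by blast

lemma linear_D\<phi>: "x \<in> U \<Longrightarrow> linear (D\<phi> x)"
  using has_derivative_\<phi> has_derivative_linear by blast

lemma isCont_\<psi>: "u \<in> V \<Longrightarrow> isCont \<psi> u"
  using continuous_\<psi> openV by (simp add: continuous_on_eq_continuous_at)

lemma chart_ball:
  assumes "u \<in> V" "0 < \<eta>"
  obtains r where "0 < r" "\<And>x. x \<in> ball (\<psi> u) r \<Longrightarrow> x \<in> U \<and> \<phi> x \<in> ball u \<eta>"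
proof -
  have "isCont \<phi> (\<psi> u)"
    using continuous_\<phi> openU \<phi>_\<psi>[OF assms(1)] by (simp add: continuous_on_eq_continuous_at)
  then obtain r1 where r1: "0 < r1" "\<And>x. dist x (\<psi> u) < r1 \<Longrightarrow> dist (\<phi> x) u < \<eta>"
    using assms(2) \<phi>_\<psi>[OF assms(1)] unfolding continuous_at_eps_delta by metis
  obtain r2 where r2: "0 < r2" "ball (\<psi> u) r2 \<subseteq> U"
    using openU \<phi>_\<psi>[OF assms(1)] open_contains_ball by blast
  show ?thesis
    by (rule that[of "min r1 r2"]) (use r1 r2 in \<open>auto simp: dist_commute subset_iff\<close>)
qed

lemma projection:
  obtains \<pi> where "linear \<pi>" "range \<pi> \<subseteq> L" "\<forall>x\<in>L. \<pi> x = x"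
  using linear_exists_left_inverse_on[OF linear_id subspaceL] by auto

text \<open>Chart lines through \<open>u\<close> in directions of \<open>L\<close> supply tangent
  vectors; conversely the chart sees a curve in \<open>X\<close> as a curve in \<open>L\<close>,
  whose velocity stays in \<open>L\<close>.\<close>

lemma tangent_space_eq:
  assumes "u \<in> V" "u \<in> L"
  shows "tangent_space X (\<psi> u) = D\<psi> u ` L"
proof
  show "D\<psi> u ` L \<subseteq> tangent_space X (\<psi> u)"
  proof clarify
    fix l assume "l \<in> L"
    obtain d where d: "0 < d" "ball u d \<subseteq> V" using openV assms open_contains_ball by blast
    \<comment> \<open>The summand 1 covers the case \<open>l = 0\<close>.\<close>
    define e where "e = d / (norm l + 1)"
    have "0 < e" unfolding e_def using d(1) by (simp add: add_nonneg_pos)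
    have inV: "u + t *\<^sub>R l \<in> V" if "t \<in> {-e<..<e}" for t
    proof -
      have "norm (t *\<^sub>R l) \<le> \<bar>t\<bar> * (norm l + 1)" by (simp add: mult_left_mono)
      also have "\<dots> < e * (norm l + 1)"
        using that by (intro mult_strict_right_mono) (auto simp: add_nonneg_pos)
      also have "\<dots> = d" unfolding e_def by (simp add: add_nonneg_eq_0_iff)
      finally have "u + t *\<^sub>R l \<in> ball u d" by (simp add: dist_norm)
      then show ?thesis using d by blast
    qed
    have "smooth_on {-e<..<e} (\<lambda>t. \<psi> (u + t *\<^sub>R l))"
      using Ck_on_compose_line[of "{-e<..<e}" u l V _ \<psi>] inV smooth_\<psi> unfolding smooth_on_def by auto
    moreover have "(\<lambda>t. \<psi> (u + t *\<^sub>R l)) ` {-e<..<e} \<subseteq> X"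
      using inV \<psi>_in_X subspace_add[OF subspaceL assms(2) subspace_scale[OF subspaceL \<open>l \<in> L\<close>]] by auto
    moreover have "((\<lambda>t. \<psi> (u + t *\<^sub>R l)) has_vector_derivative D\<psi> u l) (at 0)"
    proof -
      have "((\<lambda>t. u + t *\<^sub>R l) has_derivative (\<lambda>s. s *\<^sub>R l)) (at 0)"
        by (auto intro!: derivative_eq_intros)
      then have "((\<lambda>t. \<psi> (u + t *\<^sub>R l)) has_derivative (\<lambda>s. D\<psi> u (s *\<^sub>R l))) (at 0)"
        by (rule has_derivative_compose) (use has_derivative_\<psi> assms in simp)
      then show ?thesis
        using linear_D\<psi>[OF assms(1)] by (simp add: has_vector_derivative_def linear_scale)
    qed
    ultimately show "D\<psi> u l \<in> tangent_space X (\<psi> u)"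
      unfolding tangent_space_def using \<open>0 < e\<close> by force
  qed
  show "tangent_space X (\<psi> u) \<subseteq> D\<psi> u ` L"
  proof
    fix v assume "v \<in> tangent_space X (\<psi> u)"
    then obtain \<gamma> e where \<gamma>: "0 < e" "\<gamma> ` {-e<..<e::real} \<subseteq> X" "\<gamma> 0 = \<psi> u"
      "(\<gamma> has_vector_derivative v) (at 0)"
      unfolding tangent_space_def by blast
    have D: "((\<lambda>t. \<phi> (\<gamma> t)) has_vector_derivative D\<phi> (\<psi> u) v) (at 0)"
    proof -
      have "((\<lambda>t. \<phi> (\<gamma> t)) has_derivative (\<lambda>s. D\<phi> (\<psi> u) (s *\<^sub>R v))) (at 0)"
        using \<gamma>(4) unfolding has_vector_derivative_def
        by (rule has_derivative_compose) (use has_derivative_\<phi> \<phi>_\<psi> \<gamma>(3) assms in simp)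
      then show ?thesis
        using linear_D\<phi> \<phi>_\<psi>[OF assms(1)] by (simp add: has_vector_derivative_def linear_scale)
    qed
    obtain \<pi> where \<pi>: "linear \<pi>" "range \<pi> \<subseteq> L" "\<forall>x\<in>L. \<pi> x = x"
      using projection by blast
    have "isCont \<gamma> 0" using \<gamma>(4) has_vector_derivative_continuous by blast
    then have "(\<gamma> \<longlongrightarrow> \<gamma> 0) (nhds 0)" by (simp add: isCont_def tendsto_at_iff_tendsto_nhds)
    then have "\<forall>\<^sub>F t in nhds 0. \<gamma> t \<in> U"
      using openU \<phi>_\<psi>[OF assms(1)] \<gamma>(3) by (intro topological_tendstoD) auto
    moreover have "\<forall>\<^sub>F t in nhds 0. t \<in> {-e<..<e}"
      using \<gamma>(1) by (intro eventually_nhds_in_open) auto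
    \<comment> \<open>Near 0 the curve \<open>\<phi> \<circ> \<gamma>\<close> is fixed by the
      projection \<open>\<pi>\<close> onto \<open>L\<close>, so its velocity is fixed as well and
      lies in the range of \<open>\<pi>\<close>.\<close>
    ultimately have ev: "\<forall>\<^sub>F t in nhds 0. \<phi> (\<gamma> t) = \<pi> (\<phi> (\<gamma> t))"
    proof eventually_elim
      case (elim t)
      then show ?case using \<phi>_in_L \<gamma>(2) \<pi>(3) by force
    qed
    have "((\<lambda>t. \<pi> (\<phi> (\<gamma> t))) has_vector_derivative \<pi> (D\<phi> (\<psi> u) v)) (at 0)"
      using bounded_linear.has_vector_derivative[OF _ D, of \<pi>] \<pi>(1) by (simp add: linear_conv_bounded_linear)
    moreover have "\<forall>\<^sub>F t in nhds 0. t \<in> UNIV \<longrightarrow> \<pi> (\<phi> (\<gamma> t)) = \<phi> (\<gamma> t)"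
      using ev by eventually_elim simp
    ultimately have "((\<lambda>t. \<phi> (\<gamma> t)) has_vector_derivative \<pi> (D\<phi> (\<psi> u) v)) (at 0)"
      using has_vector_derivative_cong_ev eventually_nhds_x_imp_x[OF ev] by metis
    then have "\<pi> (D\<phi> (\<psi> u) v) = D\<phi> (\<psi> u) v"
      using D vector_derivative_unique_at by blast
    then have "D\<phi> (\<psi> u) v \<in> L" using \<pi>(2) by (metis rangeI subsetD)
    then show "v \<in> D\<psi> u ` L" using D\<psi>_D\<phi>[OF assms(1)] by (metis imageI)
  qed
qed

lemma subspace_tangent_space: "u \<in> V \<Longrightarrow> u \<in> L \<Longrightarrow> subspace (tangent_space X (\<psi> u))"
  by (simp add: tangent_space_eq linear_D\<psi> linear_subspace_image subspaceL)

text \<open>Near \<open>\<psi> u\<close> the identity of \<open>X\<close> is \<open>\<psi> \<circ> \<pi> \<circ> \<phi>\<close>, where \<open>\<pi>\<close> is a linear projection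
  onto \<open>L\<close>, and the derivative of this map takes values in the tangent space.\<close>

lemma has_derivative_normal:
  assumes "u \<in> V" "u \<in> L" "\<And>v. v \<in> tangent_space X (\<psi> u) \<Longrightarrow> \<nu> \<bullet> v = 0"
  shows "((\<lambda>x. \<nu> \<bullet> x) has_derivative (\<lambda>h. 0)) (at (\<psi> u) within X)"
proof -
  obtain \<pi> where \<pi>: "linear \<pi>" "range \<pi> \<subseteq> L" "\<forall>x\<in>L. \<pi> x = x"
    using projection by blast
  have "\<pi> u = u" using \<pi> assms by blast
  have "((\<lambda>x. \<pi> (\<phi> x)) has_derivative (\<lambda>h. \<pi> (D\<phi> (\<psi> u) h))) (at (\<psi> u))"
    using linear_imp_has_derivative[OF \<pi>(1)] has_derivative_\<phi>[of "\<psi> u"] \<phi>_\<psi>[OF assms(1)]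
    by (auto intro: has_derivative_compose)
  moreover have "(\<psi> has_derivative D\<psi> u) (at (\<pi> (\<phi> (\<psi> u))))"
    using has_derivative_\<psi>[OF assms(1)] \<open>\<pi> u = u\<close> \<phi>_\<psi>[OF assms(1)] by simp
  ultimately have "((\<lambda>x. \<psi> (\<pi> (\<phi> x))) has_derivative (\<lambda>h. D\<psi> u (\<pi> (D\<phi> (\<psi> u) h)))) (at (\<psi> u))"
    by (rule has_derivative_compose)
  then have "((\<lambda>x. \<nu> \<bullet> \<psi> (\<pi> (\<phi> x))) has_derivative (\<lambda>h. \<nu> \<bullet> D\<psi> u (\<pi> (D\<phi> (\<psi> u) h)))) (at (\<psi> u) within X)"
    by (rule has_derivative_at_withinI[OF has_derivative_inner_right])
  moreover have "\<nu> \<bullet> D\<psi> u (\<pi> (D\<phi> (\<psi> u) h)) = 0" for h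
    using assms(3) \<pi>(2) tangent_space_eq[OF assms(1,2)] by blast
  ultimately have D: "((\<lambda>x. \<nu> \<bullet> \<psi> (\<pi> (\<phi> x))) has_derivative (\<lambda>h. 0)) (at (\<psi> u) within X)" by simp
  obtain d where d: "0 < d" "ball (\<psi> u) d \<subseteq> U"
    using openU \<phi>_\<psi>[OF assms(1)] open_contains_ball by blast
  show ?thesis
    by (rule has_derivative_transform_within[OF D d(1)])
      (use \<psi>_in_X[OF assms(1,2)] d(2) \<psi>_\<phi> \<phi>_in_L \<pi>(3) in \<open>auto simp: subset_iff dist_commute\<close>)
qed

end

section \<open>Points of differentiability\<close>

text \<open>A derivative within \<open>X\<close> is an ambient linear map of which only the values
  on tangent vectors are meaningful; testing it along a curve reduces claims about these values to
  one real variable.\<close>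

lemma tangent_space_chain:
  fixes F :: "'a::euclidean_space \<Rightarrow> real"
  assumes "v \<in> tangent_space X x" and F: "(F has_derivative F') (at x within X)"
  obtains \<gamma> e where "0 < e" "\<gamma> ` {-e<..<e::real} \<subseteq> X" "\<gamma> 0 = x" "(\<gamma> has_vector_derivative v) (at 0)"
    "((\<lambda>t. F (\<gamma> t)) has_real_derivative F' v) (at 0)"
proof -
  obtain \<gamma> e where \<gamma>: "0 < e" "\<gamma> ` {-e<..<e::real} \<subseteq> X" "\<gamma> 0 = x" "(\<gamma> has_vector_derivative v) (at 0)"
    using assms unfolding tangent_space_def by blast
  have "(\<gamma> has_derivative (\<lambda>s. s *\<^sub>R v)) (at 0 within {-e<..<e})"
    using \<gamma>(4) unfolding has_vector_derivative_def by (rule has_derivative_at_withinI)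
  moreover have "(F has_derivative F') (at (\<gamma> 0) within \<gamma> ` {-e<..<e})"
    using has_derivative_subset[OF F] \<gamma>(2,3) by simp
  ultimately have "((\<lambda>t. F (\<gamma> t)) has_derivative (\<lambda>s. F' (s *\<^sub>R v))) (at 0 within {-e<..<e})"
    by (rule has_derivative_in_compose)
  moreover have "(\<lambda>s. F' (s *\<^sub>R v)) = (*) (F' v)"
    using linear_scale[OF has_derivative_linear[OF F]] by (simp add: fun_eq_iff)
  moreover have "at (0::real) within {-e<..<e} = at 0"
    using \<gamma>(1) by (intro at_within_open) auto
  ultimately have "((\<lambda>t. F (\<gamma> t)) has_real_derivative F' v) (at 0)"
    by (simp only: has_field_derivative_def)
  then show ?thesis by (rule that[OF \<gamma>])
qed

text \<open>Along a curve of velocity \<open>g\<close> the function grows at rate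
  \<open>g \<bullet> g\<close>, but with Lipschitz constant 1 it cannot grow faster than the curve
  moves, at speed \<open>norm g\<close>. The bound provides the compactness of limiting
  gradients.\<close>

lemma norm_gradient_le_1:
  assumes "has_gradient_on X f x g" "\<And>y z. \<bar>f y - f z\<bar> \<le> dist y z"
  shows "norm g \<le> 1"
proof -
  have g: "g \<in> tangent_space X x" "(f has_derivative (\<lambda>h. g \<bullet> h)) (at x within X)"
    using assms(1) by (auto simp: has_gradient_on_def)
  obtain \<gamma> where \<gamma>: "\<gamma> 0 = x" "(\<gamma> has_vector_derivative g) (at 0)"
    and f\<gamma>: "((\<lambda>t. f (\<gamma> t)) has_real_derivative g \<bullet> g) (at 0)"
    by (rule tangent_space_chain[OF g])
  have "norm g * norm g \<le> norm g + \<epsilon>" if "0 < \<epsilon>" for \<epsilon>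
  proof -
    have "0 < \<epsilon> / 2" using that by simp
    from \<gamma>(2)[unfolded has_vector_derivative_def has_derivative_at_alt] this
    obtain d1 where d1: "0 < d1"
      "\<And>t. norm (t - 0) < d1 \<Longrightarrow> norm (\<gamma> t - \<gamma> 0 - (t - 0) *\<^sub>R g) \<le> \<epsilon>/2 * norm (t - 0)"
      by blast
    from f\<gamma>[unfolded has_field_derivative_def has_derivative_at_alt] \<open>0 < \<epsilon> / 2\<close>
    obtain d2 where d2: "0 < d2"
      "\<And>t. norm (t - 0) < d2 \<Longrightarrow> norm (f (\<gamma> t) - f (\<gamma> 0) - g \<bullet> g * (t - 0)) \<le> \<epsilon>/2 * norm (t - 0)"
      by blast
    define t where "t = min d1 d2 / 2"
    have t: "0 < t" "t < d1" "t < d2" using d1(1) d2(1) by (auto simp: t_def)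
    have "norm (\<gamma> t - \<gamma> 0) \<le> norm (t *\<^sub>R g) + norm (\<gamma> t - \<gamma> 0 - t *\<^sub>R g)"
      by (metis add_diff_cancel_left' diff_add_cancel norm_triangle_ineq)
    then have "norm (\<gamma> t - \<gamma> 0) \<le> t * norm g + \<epsilon>/2 * t"
      using d1(2)[of t] t by simp
    moreover have "\<bar>f (\<gamma> t) - f (\<gamma> 0)\<bar> \<le> norm (\<gamma> t - \<gamma> 0)" using assms(2) by (simp add: dist_norm)
    moreover have "\<bar>f (\<gamma> t) - f (\<gamma> 0) - g \<bullet> g * t\<bar> \<le> \<epsilon>/2 * t" using d2(2)[of t] t by simp
    ultimately have "g \<bullet> g * t \<le> norm g * t + \<epsilon> * t"
      by (simp only: abs_le_iff minus_diff_eq mult.commute[of t]) linarith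
    then have "g \<bullet> g * t \<le> (norm g + \<epsilon>) * t" by (simp add: distrib_right)
    then show ?thesis using t by (simp add: dot_square_norm power2_eq_square)
  qed
  then have "norm g * norm g \<le> norm g * 1" by (metis field_le_epsilon mult.right_neutral)
  then show ?thesis by (metis mult_le_cancel_left norm_ge_zero order_le_less zero_le_one)
qed

lemma has_derivative_squeeze:
  fixes f :: "'a::real_normed_vector \<Rightarrow> real"
  assumes "(l has_derivative D) (at z within S)" "(q has_derivative D) (at z within S)"
    and "l z = f z" "q z = f z" and d: "0 < d"
    and "\<And>x. x \<in> S \<Longrightarrow> dist x z < d \<Longrightarrow> l x \<le> f x \<and> f x \<le> q x"
  shows "(f has_derivative D) (at z within S)"
  unfolding has_derivative_within_alt2
proof (intro conjI allI impI)
  show "bounded_linear D" using assms(1) by (rule has_derivative_bounded_linear)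
  fix e :: real assume "0 < e"
  have "\<forall>\<^sub>F y in at z within S. norm (l y - l z - D (y - z)) \<le> e * norm (y - z)"
    "\<forall>\<^sub>F y in at z within S. norm (q y - q z - D (y - z)) \<le> e * norm (y - z)"
    using assms(1,2) \<open>0 < e\<close> unfolding has_derivative_within_alt2 by blast+
  moreover have "\<forall>\<^sub>F y in at z within S. l y \<le> f y \<and> f y \<le> q y"
    unfolding eventually_at using d assms(6) by blast
  ultimately show "\<forall>\<^sub>F y in at z within S. norm (f y - f z - D (y - z)) \<le> e * norm (y - z)"
    by eventually_elim (use assms(3,4) in auto)
qed

context slice_chart
begin

text \<open>On \<open>X\<close> the difference \<open>q - l\<close> has a local minimum at
  \<open>\<psi> u\<close>, so \<open>m\<close> and \<open>n\<close> agree on tangent vectors. Their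
  normal parts are invisible within \<open>X\<close>; both bounds thus have the derivative given by
  the tangential part \<open>g\<close> of \<open>n\<close>, and \<open>f\<close> is squeezed between
  them.\<close>

lemma has_gradient_on_sandwich:
  assumes u: "u \<in> V" "u \<in> L" and d: "0 < d"
    and lq: "\<And>x. x \<in> X \<Longrightarrow> dist x (\<psi> u) < d \<Longrightarrow> l x \<le> f x \<and> f x \<le> q x"
    and eq: "l (\<psi> u) = f (\<psi> u)" "q (\<psi> u) = f (\<psi> u)"
    and l: "(l has_derivative (\<lambda>h. m \<bullet> h)) (at (\<psi> u))"
    and q: "(q has_derivative (\<lambda>h. n \<bullet> h)) (at (\<psi> u))"
  obtains g where "has_gradient_on X f (\<psi> u) g" "\<And>v. v \<in> tangent_space X (\<psi> u) \<Longrightarrow> g \<bullet> v = n \<bullet> v"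
proof -
  let ?z = "\<psi> u" let ?T = "tangent_space X (\<psi> u)"
  have mn: "m \<bullet> v = n \<bullet> v" if v: "v \<in> ?T" for v
  proof -
    have D: "((\<lambda>x. q x - l x) has_derivative (\<lambda>h. n \<bullet> h - m \<bullet> h)) (at ?z within X)"
      by (rule has_derivative_diff[OF has_derivative_at_withinI[OF q] has_derivative_at_withinI[OF l]])
    obtain \<gamma> e where \<gamma>: "0 < e" "\<gamma> ` {-e<..<e::real} \<subseteq> X" "\<gamma> 0 = ?z" "(\<gamma> has_vector_derivative v) (at 0)"
      and ql: "((\<lambda>t. q (\<gamma> t) - l (\<gamma> t)) has_real_derivative (n \<bullet> v - m \<bullet> v)) (at 0)"
      by (rule tangent_space_chain[OF v D])
    have "isCont \<gamma> 0" using \<gamma>(4) has_vector_derivative_continuous by blast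
    then obtain e' where e': "0 < e'" "\<And>t. dist t 0 < e' \<Longrightarrow> dist (\<gamma> t) (\<gamma> 0) < d"
      using d unfolding continuous_at_eps_delta by metis
    have "n \<bullet> v - m \<bullet> v = 0"
    proof (rule DERIV_local_min[OF ql, of "min e e'"])
      show "\<forall>y. \<bar>0 - y\<bar> < min e e' \<longrightarrow> q (\<gamma> 0) - l (\<gamma> 0) \<le> q (\<gamma> y) - l (\<gamma> y)"
      proof (intro allI impI)
        fix y :: real assume y: "\<bar>0 - y\<bar> < min e e'"
        have "l (\<gamma> y) \<le> f (\<gamma> y) \<and> f (\<gamma> y) \<le> q (\<gamma> y)"
          using y \<gamma>(3) e'(2)[of y] by (intro lq subsetD[OF \<gamma>(2)] imageI) auto
        then show "q (\<gamma> 0) - l (\<gamma> 0) \<le> q (\<gamma> y) - l (\<gamma> y)" using eq \<gamma>(3) by simp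
      qed
    qed (use \<gamma>(1) e'(1) in auto)
    then show ?thesis by simp
  qed
  obtain g \<nu> where g: "g \<in> span ?T" "\<And>w. w \<in> span ?T \<Longrightarrow> orthogonal \<nu> w" "n = g + \<nu>"
    using orthogonal_subspace_decomp_exists by blast
  have gT: "g \<in> ?T" using g(1) subspace_tangent_space[OF u] by (simp add: span_eq_iff[THEN iffD2])
  have \<nu>: "\<nu> \<bullet> v = 0" if "v \<in> ?T" for v using g(2)[OF span_base[OF that]] by (simp add: orthogonal_def)
  have gn: "g \<bullet> v = n \<bullet> v" if "v \<in> ?T" for v using \<nu>[OF that] g(3) by (simp add: inner_add_left)
  \<comment> \<open>The vector \<open>p - g\<close> is normal to \<open>X\<close>, so its linear
    function has derivative 0 within \<open>X\<close>; subtracting it and adding it back replaces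
    \<open>p\<close> by \<open>g\<close>.\<close>
  have tang: "(k has_derivative (\<lambda>h. g \<bullet> h)) (at ?z within X)"
    if k: "(k has_derivative (\<lambda>h. p \<bullet> h)) (at ?z)" and p: "\<And>v. v \<in> ?T \<Longrightarrow> p \<bullet> v = n \<bullet> v" for k p
  proof -
    have N: "((\<lambda>x. (p - g) \<bullet> x) has_derivative (\<lambda>h. 0)) (at ?z within X)"
      using gn p by (intro has_derivative_normal[OF u]) (simp add: inner_diff_left)
    have "((\<lambda>x. k x - (p - g) \<bullet> x) has_derivative (\<lambda>h. p \<bullet> h - (p - g) \<bullet> h)) (at ?z)"
      by (intro has_derivative_diff k) (auto intro!: derivative_eq_intros)
    from has_derivative_add[OF has_derivative_at_withinI[OF this] N]
    show ?thesis by (simp add: inner_diff_left)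
  qed
  have "(f has_derivative (\<lambda>h. g \<bullet> h)) (at ?z within X)"
    by (rule has_derivative_squeeze[OF tang[OF l mn] tang[OF q refl] eq d lq])
  then have "has_gradient_on X f ?z g" using gT \<psi>_in_X[OF u] by (simp add: has_gradient_on_def)
  then show ?thesis using gn that by blast
qed

end

section \<open>The distance function seen in a chart\<close>

locale dist_slice_chart = slice_chart +
  fixes Y :: "'a set"
  assumes closedY: "closed Y" and nonemptyY: "Y \<noteq> {}"
begin

abbreviation f where "f x \<equiv> infdist x Y"

lemma f_lipschitz: "\<bar>f x - f y\<bar> \<le> dist x y"
  by (rule infdist_triangle_abs)

text \<open>Adding to \<open>f\<close> a steep quadratic penalty centred at \<open>\<psi> u0\<close>
  forces a minimiser near the centre, and there minimality is a quadratic lower bound for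
  \<open>f\<close>; a nearest point \<open>y\<close> of \<open>Y\<close> gives the matching smooth
  upper bound.\<close>

lemma gradient_dense:
  assumes u0: "u0 \<in> V" "u0 \<in> L" "0 < f (\<psi> u0)" "0 < \<delta>"
  obtains u g y where "u \<in> V" "u \<in> L" "dist u u0 < \<delta>" "0 < f (\<psi> u)" "has_gradient_on X f (\<psi> u) g"
    "y \<in> Y" "f (\<psi> u) = norm (\<psi> u - y)"
    "\<And>v. v \<in> tangent_space X (\<psi> u) \<Longrightarrow> g \<bullet> v = sgn (\<psi> u - y) \<bullet> v"
proof -
  let ?c = "\<psi> u0"
  obtain s0 where s0: "0 < s0" "cball u0 s0 \<subseteq> V" using openV u0(1) open_contains_cball by blast
  define s where "s = min s0 (\<delta>/2)"
  have s: "0 < s" "cball u0 s \<subseteq> V" "s < \<delta>" using s0 u0(4) by (auto simp: s_def)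
  obtain r1 where r1: "0 < r1" "\<And>x. x \<in> ball ?c r1 \<Longrightarrow> x \<in> U \<and> \<phi> x \<in> ball u0 s"
    by (rule chart_ball[OF u0(1) s(1)]) (rule that)
  \<comment> \<open>The bound \<open>f ?c\<close> keeps the minimiser off \<open>Y\<close>. The
    bound \<open>r1\<close> puts all points of \<open>X\<close> near the minimiser among the
    competitors, so that the minimum over the compact set \<open>?C\<close> is a local minimum on
    \<open>X\<close>.\<close>
  define r where "r = min r1 (f ?c)"
  have r: "0 < r" "r \<le> r1" "r \<le> f ?c" using r1 u0 by (auto simp: r_def)
  \<comment> \<open>At distance at least \<open>r\<close> from \<open>?c\<close> the penalty is at
    least twice that distance, more than a function of Lipschitz constant 1 can gain by moving
    there.\<close>
  define K where "K = 2 / r"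
  let ?C = "cball u0 s \<inter> L"
  let ?F = "\<lambda>x. f x + K * (norm (x - ?c))\<^sup>2"
  have "compact ?C" using closed_subspace[OF subspaceL] by (simp add: compact_Int_closed)
  moreover have "u0 \<in> ?C" using s(1) u0 by simp
  moreover have "continuous_on ?C (\<lambda>u. ?F (\<psi> u))"
    using s(2) by (intro continuous_intros continuous_on_subset[OF continuous_\<psi>]) auto
  ultimately obtain u where u: "u \<in> ?C" "\<And>u'. u' \<in> ?C \<Longrightarrow> ?F (\<psi> u) \<le> ?F (\<psi> u')"
    using continuous_attains_inf[of ?C "\<lambda>u. ?F (\<psi> u)"] by blast
  let ?z = "\<psi> u"
  have uVL: "u \<in> V" "u \<in> L" using u(1) s(2) by auto
  have close: "norm (?z - ?c) < r"
  proof (rule ccontr)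
    assume "\<not> norm (?z - ?c) < r"
    then have ge: "r \<le> norm (?z - ?c)" by simp
    have "f ?z + K * (norm (?z - ?c))\<^sup>2 \<le> f ?c" using u(2)[OF \<open>u0 \<in> ?C\<close>] by simp
    then have "K * (norm (?z - ?c))\<^sup>2 \<le> norm (?z - ?c)"
      using f_lipschitz[of ?c ?z] by (simp add: dist_norm norm_minus_commute)
    moreover have "2 * norm (?z - ?c) \<le> K * (norm (?z - ?c))\<^sup>2"
    proof -
      have "2 * norm (?z - ?c) = K * (r * norm (?z - ?c))" using r(1) by (simp add: K_def)
      also have "\<dots> \<le> K * (norm (?z - ?c) * norm (?z - ?c))"
        using ge r(1) by (intro mult_left_mono mult_right_mono) (auto simp: K_def)
      finally show ?thesis by (simp add: power2_eq_square)
    qed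
    ultimately show False using ge r(1) by simp
  qed
  have fpos: "0 < f ?z"
    using abs_le_D1[OF f_lipschitz[of ?c ?z]] close r(3) by (simp only: dist_norm norm_minus_commute)
  obtain y where y: "y \<in> Y" "f ?z = dist ?z y"
    using infdist_attains_inf[OF closedY nonemptyY] by metis
  have "?z - y \<noteq> 0" using y fpos by auto
  \<comment> \<open>Minimality of \<open>?F\<close> at \<open>?z\<close>, solved for
    \<open>f x\<close>.\<close>
  let ?l = "\<lambda>x. ?F ?z - K * ((x - ?c) \<bullet> (x - ?c))"
  obtain g where g: "has_gradient_on X f ?z g"
    "\<And>v. v \<in> tangent_space X ?z \<Longrightarrow> g \<bullet> v = sgn (?z - y) \<bullet> v"
  proof (rule has_gradient_on_sandwich[OF uVL, of "r - norm (?z - ?c)" ?l f "\<lambda>x. norm (x - y)"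
        "- (2 * K) *\<^sub>R (?z - ?c)" "sgn (?z - y)"])
    fix x assume x: "x \<in> X" "dist x ?z < r - norm (?z - ?c)"
    then have "dist x ?c < r" using dist_triangle[of x ?c ?z] by (simp add: dist_norm)
    then have "\<phi> x \<in> ?C" "x \<in> U"
      using r1(2)[of x] r(2) \<phi>_in_L[of x] x(1) by (auto simp: dist_commute less_imp_le)
    then have "?F ?z \<le> ?F x" using u(2)[of "\<phi> x"] \<psi>_\<phi>[of x] by simp
    moreover have "f x \<le> norm (x - y)" using infdist_le[OF y(1), of x] by (simp add: dist_norm)
    ultimately show "?l x \<le> f x \<and> f x \<le> norm (x - y)" by (simp add: dot_square_norm)
  next
    show "((\<lambda>x. norm (x - y)) has_derivative (\<bullet>) (sgn (?z - y))) (at ?z)"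
    proof -
      have "((\<lambda>x. x - y) has_derivative (\<lambda>h. h)) (at ?z)"
        by (auto intro!: derivative_eq_intros)
      from has_derivative_compose[OF this has_derivative_norm[OF \<open>?z - y \<noteq> 0\<close>]]
      moreover have "(\<lambda>h. h \<bullet> sgn (?z - y)) = (\<bullet>) (sgn (?z - y))" by (simp add: fun_eq_iff inner_commute)
      ultimately show ?thesis by simp
    qed
    show "(?l has_derivative (\<bullet>) (- (2 * K) *\<^sub>R (?z - ?c))) (at ?z)"
      by (auto intro!: derivative_eq_intros simp: inner_commute inner_diff_left inner_diff_right algebra_simps)
  qed (use close y that in \<open>auto simp: dot_square_norm dist_norm\<close>)
  show ?thesis
  proof (rule that[OF uVL _ fpos g(1) y(1) _ g(2)])
    show "dist u u0 < \<delta>" using u(1) s(3) by (simp add: dist_commute)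
    show "f ?z = norm (?z - y)" using y(2) by (simp add: dist_norm)
  qed
qed

end

section \<open>Descent at noncritical points\<close>

text \<open>Compare squares: with \<open>A\<close> the sum of the last two terms, the square of the
  right side exceeds that of the left by \<open>(norm q)\<^sup>2 + A\<^sup>2\<close>.\<close>

lemma norm_add_le_linearization:
  fixes p q :: "'a::real_inner"
  assumes "p \<noteq> 0"
  shows "norm (p + q) \<le> norm p + sgn p \<bullet> q + (norm q)\<^sup>2 / norm p"
proof (rule power2_le_imp_le)
  have p: "0 < norm p" using assms by simp
  define A where "A = (p \<bullet> q + (norm q)\<^sup>2) / norm p"
  have eq: "norm p + sgn p \<bullet> q + (norm q)\<^sup>2 / norm p = norm p + A"
    by (simp add: A_def sgn_div_norm inverse_eq_divide add_divide_distrib)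
  have "norm p * A = p \<bullet> q + (norm q)\<^sup>2" using p by (simp add: A_def)
  then have A: "(norm p + A)\<^sup>2 = (norm p)\<^sup>2 + 2 * (p \<bullet> q) + 2 * (norm q)\<^sup>2 + A\<^sup>2"
    by (simp add: power2_sum)
  have "(norm (p + q))\<^sup>2 = (norm p)\<^sup>2 + 2 * (p \<bullet> q) + (norm q)\<^sup>2"
    by (simp add: power2_norm_eq_inner inner_add_left inner_add_right inner_commute)
  then show "(norm (p + q))\<^sup>2 \<le> (norm p + sgn p \<bullet> q + (norm q)\<^sup>2 / norm p)\<^sup>2"
    unfolding eq A using zero_le_power2[of A] zero_le_power2[of "norm q"] by linarith
  \<comment> \<open>Comparing squares needs a nonnegative right side; multiplied by
    \<open>2 * norm p\<close> it is this sum of squares.\<close>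
  have "0 \<le> (norm (p + q))\<^sup>2 + (norm p)\<^sup>2 + (norm q)\<^sup>2" by simp
  also have "\<dots> = 2 * (norm p * norm p + norm p * A)"
    using \<open>norm p * A = _\<close>
    by (simp add: power2_norm_eq_inner inner_add_left inner_add_right inner_commute flip: power2_eq_square)
  also have "\<dots> = 2 * (norm p * (norm p + A))" by (simp add: distrib_left)
  finally show "0 \<le> norm p + sgn p \<bullet> q + (norm q)\<^sup>2 / norm p"
    unfolding eq using p by (simp add: zero_le_mult_iff)
qed

text \<open>Keeping base points and gradients together makes the limiting gradients at
  \<open>x\<close> a slice of one closed set, the closure of the graph, to which compactness
  arguments apply.\<close>

definition gradient_graph :: "'a::euclidean_space set \<Rightarrow> ('a \<Rightarrow> real) \<Rightarrow> ('a \<times> 'a) set" where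
  "gradient_graph X f = {(x, g). has_gradient_on X f x g}"

lemma clarke_subdifferential_eq_closure:
  "clarke_subdifferential X f x = convex hull {g. (x, g) \<in> closure (gradient_graph X f)}"
proof -
  have "(\<exists>xs gs. (\<forall>k::nat. has_gradient_on X f (xs k) (gs k)) \<and> xs \<longlonglongrightarrow> x \<and> gs \<longlonglongrightarrow> g)
      \<longleftrightarrow> (x, g) \<in> closure (gradient_graph X f)" for g
  proof
    assume "\<exists>xs gs. (\<forall>k::nat. has_gradient_on X f (xs k) (gs k)) \<and> xs \<longlonglongrightarrow> x \<and> gs \<longlonglongrightarrow> g"
    then obtain xs gs where "\<And>k::nat. has_gradient_on X f (xs k) (gs k)" "xs \<longlonglongrightarrow> x" "gs \<longlonglongrightarrow> g"
      by blast
    then show "(x, g) \<in> closure (gradient_graph X f)"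
      unfolding closure_sequential
      by (intro exI[of _ "\<lambda>k. (xs k, gs k)"]) (auto simp: gradient_graph_def intro: tendsto_Pair)
  next
    assume "(x, g) \<in> closure (gradient_graph X f)"
    then obtain zs where "\<And>k::nat. zs k \<in> gradient_graph X f" "zs \<longlonglongrightarrow> (x, g)"
      unfolding closure_sequential by blast
    then show "\<exists>xs gs. (\<forall>k::nat. has_gradient_on X f (xs k) (gs k)) \<and> xs \<longlonglongrightarrow> x \<and> gs \<longlonglongrightarrow> g"
      by (intro exI[of _ "\<lambda>k. fst (zs k)"] exI[of _ "\<lambda>k. snd (zs k)"])
        (auto simp: gradient_graph_def split_beta dest: tendsto_fst tendsto_snd)
  qed
  then show ?thesis by (simp add: clarke_subdifferential_def)
qed

context slice_chart
begin

text \<open>In the chart, tangency of \<open>v\<close> at \<open>x\<close> reads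
  \<open>D\<phi> x v \<in> L\<close>, and this survives limits because \<open>L\<close> is closed
  and \<open>D\<phi>\<close> is continuous.\<close>

lemma tangent_of_closure_gradient_graph:
  assumes u: "u \<in> V" "u \<in> L" and "(\<psi> u, g) \<in> closure (gradient_graph X f)"
  shows "g \<in> tangent_space X (\<psi> u)"
proof -
  obtain zs where zs: "\<And>k::nat. zs k \<in> gradient_graph X f" "zs \<longlonglongrightarrow> (\<psi> u, g)"
    using assms(3) unfolding closure_sequential by blast
  define xs gs where "xs k = fst (zs k)" and "gs k = snd (zs k)" for k
  have lim: "xs \<longlonglongrightarrow> \<psi> u" "gs \<longlonglongrightarrow> g"
    using zs(2) tendsto_fst tendsto_snd unfolding xs_def gs_def by fastforce+
  have grad: "has_gradient_on X f (xs k) (gs k)" for k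
    using zs(1)[of k] by (auto simp: gradient_graph_def xs_def gs_def)
  have xU: "\<forall>\<^sub>F k in sequentially. xs k \<in> U"
    using topological_tendstoD[OF lim(1) openU] \<phi>_\<psi>[OF u(1)] by simp
  \<comment> \<open>Continuity of \<open>D\<phi>\<close> in the base point is known only for a fixed
    direction; the expansion in \<open>Basis\<close> handles directions that vary too.\<close>
  have expand: "D\<phi> x v = (\<Sum>b\<in>Basis. (v \<bullet> b) *\<^sub>R D\<phi> x b)" if "x \<in> U" for x v
  proof -
    have "D\<phi> x (\<Sum>b\<in>Basis. (v \<bullet> b) *\<^sub>R b) = (\<Sum>b\<in>Basis. (v \<bullet> b) *\<^sub>R D\<phi> x b)"
      using linear_D\<phi>[OF that] by (simp add: linear_sum linear_scale)
    then show ?thesis by (simp add: euclidean_representation)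
  qed
  have "(\<lambda>k. D\<phi> (xs k) b) \<longlonglongrightarrow> D\<phi> (\<psi> u) b" for b
  proof -
    have "isCont (\<lambda>x. D\<phi> x b) (\<psi> u)"
      using smooth_on_continuous_derivative[OF smooth_\<phi>] openU \<phi>_\<psi>[OF u(1)]
      by (simp add: continuous_on_eq_continuous_at)
    then show ?thesis using lim(1) by (rule isCont_tendsto_compose)
  qed
  then have "(\<lambda>k. \<Sum>b\<in>Basis. (gs k \<bullet> b) *\<^sub>R D\<phi> (xs k) b) \<longlonglongrightarrow> (\<Sum>b\<in>Basis. (g \<bullet> b) *\<^sub>R D\<phi> (\<psi> u) b)"
    using lim(2) by (intro tendsto_intros)
  then have "(\<lambda>k. \<Sum>b\<in>Basis. (gs k \<bullet> b) *\<^sub>R D\<phi> (xs k) b) \<longlonglongrightarrow> D\<phi> (\<psi> u) g"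
    using expand[of "\<psi> u" g] \<phi>_\<psi>[OF u(1)] by simp
  moreover have "\<forall>\<^sub>F k in sequentially. (\<Sum>b\<in>Basis. (gs k \<bullet> b) *\<^sub>R D\<phi> (xs k) b) \<in> L"
    using xU
  proof eventually_elim
    case (elim k)
    have "xs k \<in> X" "gs k \<in> tangent_space X (xs k)" using grad[of k] by (auto simp: has_gradient_on_def)
    then obtain l where "l \<in> L" "gs k = D\<psi> (\<phi> (xs k)) l"
      using tangent_space_eq[of "\<phi> (xs k)"] \<phi>_in_L[OF elim] \<psi>_\<phi>[OF elim] by auto
    then have "D\<phi> (xs k) (gs k) \<in> L" using D\<phi>_D\<psi>[of "\<phi> (xs k)" l] \<psi>_\<phi>[OF elim] by simp
    then show ?case using expand[OF elim, of "gs k"] by simp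
  qed
  ultimately have "D\<phi> (\<psi> u) g \<in> L"
    by (rule Lim_in_closed_set[OF closed_subspace[OF subspaceL] _ sequentially_bot, rotated])
  then show ?thesis using tangent_space_eq[OF u] D\<psi>_D\<phi>[OF u(1), of g] by (metis imageI)
qed

end

context dist_slice_chart
begin

lemma closure_gradient_graph_norm_le_1:
  assumes "(x, g) \<in> closure (gradient_graph X f)"
  shows "norm g \<le> 1"
proof -
  have "gradient_graph X f \<subseteq> UNIV \<times> cball 0 1"
    using norm_gradient_le_1[OF _ f_lipschitz] by (auto simp: gradient_graph_def)
  then have "closure (gradient_graph X f) \<subseteq> UNIV \<times> cball 0 1"
    by (rule closure_minimal) (intro closed_Times closed_UNIV closed_cball)
  then show ?thesis using assms by auto
qed

text \<open>The point \<open>a\<close> of the compact convex subdifferential closest to 0 satisfies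
  \<open>a \<bullet> a \<le> a \<bullet> g\<close> for all limiting gradients \<open>g\<close>, and
  it is tangent as the subdifferential is. Compactness extends the estimate to gradients at nearby
  points, at half the constant.\<close>

lemma uniform_ascent_direction:
  assumes u: "u \<in> V" "u \<in> L" and "0 \<notin> clarke_subdifferential X f (\<psi> u)"
  obtains a c d where "a \<in> tangent_space X (\<psi> u)" "0 < c" "0 < d"
    "\<And>x g. has_gradient_on X f x g \<Longrightarrow> dist x (\<psi> u) < d \<Longrightarrow> c \<le> a \<bullet> g"
proof -
  let ?T = "tangent_space X (\<psi> u)" and ?\<Gamma> = "closure (gradient_graph X f)"
  let ?G = "{g. (\<psi> u, g) \<in> ?\<Gamma>}"
  have T: "subspace ?T" by (rule subspace_tangent_space[OF u])
  have "\<exists>a\<in>?T. \<exists>c>0. \<forall>g\<in>?G. c \<le> a \<bullet> g"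
  proof (cases "?G = {}")
    case True
    \<comment> \<open>Without limiting gradients the estimate is vacuous, so any \<open>a\<close>
      and \<open>c\<close> will do.\<close>
    then show ?thesis by (intro bexI[of _ 0] exI[of _ 1]) (use subspace_0[OF T] in auto)
  next
    case False
    let ?C = "convex hull ?G"
    have "closed ?G"
      using closed_vimage[of ?\<Gamma> "Pair (\<psi> u)"] by (simp add: vimage_def continuous_on_Pair)
    moreover have "bounded ?G" using closure_gradient_graph_norm_le_1 by (auto simp: bounded_iff)
    ultimately have "closed ?C"
      by (intro compact_imp_closed compact_convex_hull) (simp add: compact_eq_bounded_closed)
    have "?C \<subseteq> ?T"
      using tangent_of_closure_gradient_graph[OF u] T by (intro hull_minimal) (auto simp: subspace_imp_convex)
    let ?a = "closest_point ?C 0"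
    have aC: "?a \<in> ?C" using False \<open>closed ?C\<close> by (intro closest_point_in_set) auto
    have "0 \<notin> ?C" using assms(3) by (simp add: clarke_subdifferential_eq_closure)
    then have "0 < ?a \<bullet> ?a" using aC by auto
    moreover have "?a \<bullet> ?a \<le> ?a \<bullet> g" if "g \<in> ?G" for g
      using closest_point_dot[OF convex_convex_hull \<open>closed ?C\<close> hull_inc[OF that], of 0]
      by (simp add: inner_diff_right)
    ultimately show ?thesis using aC \<open>?C \<subseteq> ?T\<close> by blast
  qed
  then obtain a c where a: "a \<in> ?T" "0 < c" "\<And>g. (\<psi> u, g) \<in> ?\<Gamma> \<Longrightarrow> c \<le> a \<bullet> g" by blast
  \<comment> \<open>\<open>?B\<close> collects the possible gradients that violate the estimate. As
    it is compact, the points with such a limiting gradient form a closed set \<open>?S\<close>; it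
    misses \<open>\<psi> u\<close>, hence a whole ball.\<close>
  let ?B = "cball (0::'a) 1 \<inter> {g. a \<bullet> g \<le> c/2}"
  let ?S = "{x. \<exists>g. g \<in> ?B \<and> (x, g) \<in> ?\<Gamma>}"
  have "compact ?B" by (intro compact_Int_closed compact_cball closed_halfspace_le)
  moreover have "closed (prod.swap -` ?\<Gamma>)" by (intro closed_vimage closed_closure continuous_on_swap)
  ultimately have "closed ?S" using closed_compact_projection by fastforce
  moreover have "\<psi> u \<notin> ?S" using a(2,3) by force
  ultimately obtain d where d: "0 < d" "ball (\<psi> u) d \<inter> ?S = {}"
    by (metis (no_types, lifting) Compl_iff closed_def open_contains_ball disjoint_eq_subset_Compl)
  show ?thesis
  proof (rule that[OF a(1) _ d(1), of "c/2"])
    fix x g assume g: "has_gradient_on X f x g" "dist x (\<psi> u) < d"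
    then have "(x, g) \<in> ?\<Gamma>" using closure_subset by (fastforce simp: gradient_graph_def)
    moreover have "x \<in> ball (\<psi> u) d" using g(2) by (simp add: dist_commute)
    then have "x \<notin> ?S" using d(2) by blast
    ultimately show "c/2 \<le> a \<bullet> g" using closure_gradient_graph_norm_le_1 by force
  qed (use a in simp)
qed

text \<open>Only the radius \<open>r\<close> depends on \<open>u\<close>, since the quadratic error
  is divided by the distance to \<open>Y\<close>. That \<open>w\<close> and \<open>c\<close> serve
  the whole ball, also when \<open>\<psi> u0\<close> lies in \<open>Y\<close>, is what allows points
  of \<open>Y\<close> to be excluded.\<close>

lemma local_descent:
  assumes u0: "u0 \<in> V" "u0 \<in> L" and "0 \<notin> clarke_subdifferential X f (\<psi> u0)"
  obtains w c \<delta> where "w \<in> L" "0 < c" "0 < \<delta>" "ball u0 \<delta> \<subseteq> V"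
    "\<And>u. u \<in> ball u0 \<delta> \<Longrightarrow> u \<in> L \<Longrightarrow> 0 < f (\<psi> u) \<Longrightarrow>
      \<exists>r>0. \<forall>u'\<in>ball u r \<inter> L. \<forall>t\<in>{0..r}. f (\<psi> (u' + t *\<^sub>R w)) \<le> f (\<psi> u') - c * t"
proof -
  obtain a c d where a: "a \<in> tangent_space X (\<psi> u0)" "0 < c" "0 < d"
    and ag: "\<And>x g. has_gradient_on X f x g \<Longrightarrow> dist x (\<psi> u0) < d \<Longrightarrow> c \<le> a \<bullet> g"
    by (rule uniform_ascent_direction[OF assms]) (rule that)
  \<comment> \<open>The chart direction that \<open>D\<psi> u0\<close> sends to the descent
    direction \<open>- a\<close>.\<close>
  define w where "w = - D\<phi> (\<psi> u0) a"
  have w: "w \<in> L" "D\<psi> u0 w = - a"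
  proof -
    obtain l where "l \<in> L" "a = D\<psi> u0 l" using a(1) tangent_space_eq[OF u0] by blast
    then show "w \<in> L" using D\<phi>_D\<psi>[OF u0(1)] subspace_neg[OF subspaceL] by (simp add: w_def)
    show "D\<psi> u0 w = - a"
      using D\<psi>_D\<phi>[OF u0(1)] linear_neg[OF linear_D\<psi>[OF u0(1)]] by (simp add: w_def)
  qed
  \<comment> \<open>The errors sum to \<open>3 * \<epsilon>\<close> from the linearisation and
    \<open>c / 8\<close> from the quadratic term, half of \<open>c\<close> altogether; a rate
    \<open>c/2\<close> remains.\<close>
  define \<epsilon> where "\<epsilon> = c / 8"
  have "0 < \<epsilon>" using a(2) by (simp add: \<epsilon>_def)
  obtain d0 where d0: "0 < d0" "ball u0 d0 \<subseteq> V" using openV u0(1) open_contains_ball by blast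
  have "isCont (\<lambda>u. D\<psi> u w) u0"
    using smooth_on_continuous_derivative[OF smooth_\<psi>] openV u0(1) by (simp add: continuous_on_eq_continuous_at)
  then obtain d1 where d1: "0 < d1" "\<And>u. dist u u0 < d1 \<Longrightarrow> dist (D\<psi> u w) (- a) < \<epsilon>"
    using \<open>0 < \<epsilon>\<close> w(2) unfolding continuous_at_eps_delta by metis
  obtain d2 where d2: "0 < d2" "\<And>u. dist u u0 < d2 \<Longrightarrow> dist (\<psi> u) (\<psi> u0) < d"
    using isCont_\<psi>[OF u0(1)] a(3) unfolding continuous_at_eps_delta by metis
  define \<delta> where "\<delta> = min d0 (min d1 d2)"
  have \<delta>: "0 < \<delta>" "ball u0 \<delta> \<subseteq> V" using d0 d1 d2 by (auto simp: \<delta>_def)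
  have Dw: "norm (D\<psi> u w + a) \<le> \<epsilon>" if "u \<in> ball u0 \<delta>" for u
    using d1(2)[of u] that by (simp add: \<delta>_def dist_norm norm_minus_commute)
  have ag': "c \<le> a \<bullet> g" if "u \<in> ball u0 \<delta>" "has_gradient_on X f (\<psi> u) g" for u g
    using ag[OF that(2)] d2(2)[of u] that(1) by (simp add: \<delta>_def dist_commute)
  have "\<exists>r>0. \<forall>u'\<in>ball u r \<inter> L. \<forall>t\<in>{0..r}. f (\<psi> (u' + t *\<^sub>R w)) \<le> f (\<psi> u') - c/2 * t"
    if u: "u \<in> ball u0 \<delta>" "u \<in> L" "0 < f (\<psi> u)" for u
  proof -
    define m where "m = f (\<psi> u) / 2"
    have "0 < m" using u(3) by (simp add: m_def)
    have "isCont (\<lambda>u. f (\<psi> u)) u" using isCont_\<psi>[of u] u(1) \<delta>(2) by (intro continuous_infdist) auto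
    then obtain r2 where r2: "0 < r2" "\<And>u'. dist u' u < r2 \<Longrightarrow> dist (f (\<psi> u')) (f (\<psi> u)) < m"
      using \<open>0 < m\<close> unfolding continuous_at_eps_delta by metis
    have fm: "m \<le> f (\<psi> u')" if "dist u' u < r2" for u'
      using r2(2)[OF that] unfolding m_def dist_real_def by linarith
    define M where "M = norm a + c"
    have "0 < M" using a(2) by (simp add: M_def add_nonneg_pos)
    \<comment> \<open>The three bounds keep the distance at least \<open>m\<close>, keep the
      segments in \<open>ball u0 \<delta>\<close>, and make the quadratic error at most
      \<open>t * (c / 8)\<close>; \<open>M\<close> bounds the speed of \<open>\<psi>\<close> along
      the segments.\<close>
    define r where "r = min r2 (min ((\<delta> - dist u u0) / (1 + norm w)) (c * m / (8 * M\<^sup>2)))"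
    have r: "0 < r" "r \<le> r2" "r * M\<^sup>2 / m \<le> c / 8" "r * (1 + norm w) \<le> \<delta> - dist u u0"
    proof -
      have "0 < 1 + norm w" by (simp add: add_pos_nonneg)
      then show "0 < r" using r2(1) u(1) a(2) \<open>0 < m\<close> \<open>0 < M\<close> by (simp add: r_def dist_commute)
      have "r \<le> (\<delta> - dist u u0) / (1 + norm w)" by (simp add: r_def)
      then show "r * (1 + norm w) \<le> \<delta> - dist u u0" using \<open>0 < 1 + norm w\<close> by (simp add: pos_le_divide_eq)
      have "r \<le> c * m / (8 * M\<^sup>2)" by (simp add: r_def)
      then show "r * M\<^sup>2 / m \<le> c / 8" using \<open>0 < m\<close> \<open>0 < M\<close> by (simp add: field_simps)
    qed (simp add: r_def)
    have inball: "u' + t *\<^sub>R w \<in> ball u0 \<delta>" if "u' \<in> ball u r" "t \<in> {0..r}" for u' t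
    proof -
      have "dist (u' + t *\<^sub>R w) u0 \<le> norm (t *\<^sub>R w) + (dist u' u + dist u u0)"
        using dist_triangle[of "u' + t *\<^sub>R w" u0 u'] dist_triangle[of u' u0 u] by (simp add: dist_norm)
      also have "norm (t *\<^sub>R w) \<le> r * norm w" using that(2) by (simp add: mult_right_mono)
      also have "r * norm w + (dist u' u + dist u u0) < r * norm w + (r + dist u u0)"
        using that(1) by (simp add: dist_commute)
      also have "\<dots> \<le> \<delta>" using r(4) by (simp add: algebra_simps)
      finally show ?thesis by (simp add: dist_commute)
    qed
    have inV: "u' + t *\<^sub>R w \<in> V" if "u' \<in> ball u r" "t \<in> {0..r}" for u' t
      using inball[OF that] \<delta>(2) by blast
    \<comment> \<open>The upper bound from \<open>y\<close> has the ambient gradient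
      \<open>?n\<close>, while the rate is known for \<open>g\<close>; the two agree only on tangent
      vectors. So \<open>?q\<close> is split into the tangent vector \<open>t *\<^sub>R ?D\<close>
      and a remainder of norm at most \<open>t * (2 * \<epsilon>)\<close>.\<close>
    have smooth_case: "f (\<psi> (u' + t *\<^sub>R w)) \<le> f (\<psi> u') - c/2 * t"
      if u': "u' \<in> ball u r" "u' \<in> L" and t: "t \<in> {0..r}" and g: "has_gradient_on X f (\<psi> u') g"
        and y: "y \<in> Y" "f (\<psi> u') = norm (\<psi> u' - y)"
        and gT: "\<And>v. v \<in> tangent_space X (\<psi> u') \<Longrightarrow> g \<bullet> v = sgn (\<psi> u' - y) \<bullet> v" for u' t g y
    proof -
      let ?z = "\<psi> u'" and ?z' = "\<psi> (u' + t *\<^sub>R w)" and ?n = "sgn (\<psi> u' - y)"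
      let ?q = "?z' - ?z" and ?D = "D\<psi> u' w"
      have u'B: "u' \<in> ball u0 \<delta>" "u' \<in> V" using inball[OF u'(1), of 0] inV[OF u'(1), of 0] r(1) by auto
      have fz: "m \<le> f ?z" using fm[of u'] u'(1) r(2) by (simp add: dist_commute)
      have "norm (\<psi> (u' + t *\<^sub>R w) - \<psi> (u' + 0 *\<^sub>R w) - (t - 0) *\<^sub>R D\<psi> (u' + 0 *\<^sub>R w) w)
          \<le> norm (t - 0) * (2 * \<epsilon>)"
      proof (rule vector_differentiable_bound_linearization[where S = "{0..t}"])
        fix s assume s: "s \<in> {0..t}"
        then have s': "s \<in> {0..r}" "0 \<in> {0..r}" using t by auto
        have "((\<lambda>s. u' + s *\<^sub>R w) has_derivative (\<lambda>s. s *\<^sub>R w)) (at s)"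
          by (auto intro!: derivative_eq_intros)
        from has_derivative_compose[OF this has_derivative_\<psi>[OF inV[OF u'(1) s'(1)]]]
        have "((\<lambda>s. \<psi> (u' + s *\<^sub>R w)) has_vector_derivative D\<psi> (u' + s *\<^sub>R w) w) (at s)"
          using linear_scale[OF linear_D\<psi>[OF inV[OF u'(1) s'(1)]]] by (simp add: has_vector_derivative_def)
        then show "((\<lambda>s. \<psi> (u' + s *\<^sub>R w)) has_vector_derivative D\<psi> (u' + s *\<^sub>R w) w) (at s within {0..t})"
          by (rule has_vector_derivative_at_within)
        show "norm (D\<psi> (u' + s *\<^sub>R w) w - D\<psi> (u' + 0 *\<^sub>R w) w) \<le> 2 * \<epsilon>"
          using Dw[OF inball[OF u'(1) s'(1)]] Dw[OF inball[OF u'(1) s'(2)]]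
            norm_triangle_ineq4[of "D\<psi> (u' + s *\<^sub>R w) w + a" "D\<psi> (u' + 0 *\<^sub>R w) w + a"] by simp
      qed (use t in \<open>auto simp: closed_segment_eq_real_ivl\<close>)
      then have lin: "norm (?q - t *\<^sub>R ?D) \<le> t * (2 * \<epsilon>)" using t by simp
      have Da: "norm (?D + a) \<le> \<epsilon>" by (rule Dw[OF u'B(1)])
      have "norm g \<le> 1" by (rule norm_gradient_le_1[OF g f_lipschitz])
      have "norm ?n \<le> 1" by (simp add: norm_sgn)
      have "g \<bullet> ?D = - (a \<bullet> g) + g \<bullet> (?D + a)" by (simp add: inner_add_right inner_commute)
      also have "\<dots> \<le> - c + 1 * \<epsilon>"
        using ag'[OF u'B(1) g] norm_cauchy_schwarz[of g "?D + a"]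
          mult_mono[OF \<open>norm g \<le> 1\<close> Da] by simp
      finally have gD: "g \<bullet> ?D \<le> - c + \<epsilon>" by simp
      have "?D \<in> tangent_space X ?z" using tangent_space_eq[OF u'B(2) u'(2)] w(1) by blast
      then have nD: "?n \<bullet> ?D \<le> - c + \<epsilon>" using gT gD by simp
      have "?n \<bullet> ?q = t * (?n \<bullet> ?D) + ?n \<bullet> (?q - t *\<^sub>R ?D)" by (simp add: inner_diff_right)
      also have "t * (?n \<bullet> ?D) \<le> t * (- c + \<epsilon>)" using nD t by (intro mult_left_mono) auto
      also have "?n \<bullet> (?q - t *\<^sub>R ?D) \<le> t * (2 * \<epsilon>)"
        using norm_cauchy_schwarz[of ?n "?q - t *\<^sub>R ?D"] mult_mono[OF \<open>norm ?n \<le> 1\<close> lin] by simp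
      finally have nq: "?n \<bullet> ?q \<le> t * (- c + 3 * \<epsilon>)" by (simp add: algebra_simps)
      have "norm ?q \<le> t * M"
      proof -
        have "norm ?q \<le> norm (?q - t *\<^sub>R ?D) + t * norm ?D"
          using norm_triangle_ineq[of "?q - t *\<^sub>R ?D" "t *\<^sub>R ?D"] t by simp
        also have "norm ?D \<le> norm a + \<epsilon>"
          using norm_triangle_ineq4[of "?D + a" a] Da by simp
        finally have "norm ?q \<le> t * (2 * \<epsilon>) + t * (norm a + \<epsilon>)"
          using lin t by (simp add: mult_left_mono)
        also have "\<dots> = t * (norm a + 3 * \<epsilon>)" by (simp add: algebra_simps)
        also have "\<dots> \<le> t * M" using t a(2) by (intro mult_left_mono) (auto simp: M_def \<epsilon>_def)
        finally show ?thesis .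
      qed
      then have "(norm ?q)\<^sup>2 \<le> (t * M)\<^sup>2" by (intro power_mono) auto
      then have "(norm ?q)\<^sup>2 / norm (?z - y) \<le> (t * M)\<^sup>2 / m"
        using fz y(2) \<open>0 < m\<close> by (intro frac_le) auto
      also have "\<dots> = t * (t * (M\<^sup>2 / m))" by (simp add: power2_eq_square)
      also have "\<dots> \<le> t * (r * (M\<^sup>2 / m))"
        using t \<open>0 < m\<close> by (intro mult_left_mono mult_right_mono) auto
      also have "\<dots> \<le> t * (c / 8)" using r(3) t by (intro mult_left_mono) auto
      finally have qq: "(norm ?q)\<^sup>2 / norm (?z - y) \<le> t * (c / 8)" .
      have "f ?z' \<le> norm (?z - y + ?q)" using infdist_le[OF y(1), of ?z'] by (simp add: dist_norm)
      also have "\<dots> \<le> norm (?z - y) + ?n \<bullet> ?q + (norm ?q)\<^sup>2 / norm (?z - y)"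
        using fz \<open>0 < m\<close> y(2) by (intro norm_add_le_linearization) auto
      also have "\<dots> \<le> f ?z + t * (- c + 3 * \<epsilon>) + t * (c / 8)" using nq qq y(2) by linarith
      also have "\<dots> = f ?z - c/2 * t" by (simp add: \<epsilon>_def algebra_simps)
      finally show ?thesis .
    qed
    \<comment> \<open>For fixed \<open>t\<close> a violation is an open condition on
      \<open>u'\<close>, so it would occur at one of the dense points covered by
      \<open>smooth_case\<close>.\<close>
    have "f (\<psi> (u' + t *\<^sub>R w)) \<le> f (\<psi> u') - c/2 * t" if u': "u' \<in> ball u r \<inter> L" and t: "t \<in> {0..r}" for u' t
    proof (rule ccontr)
      assume "\<not> ?thesis"
      then have pos: "0 < f (\<psi> (u' + t *\<^sub>R w)) - f (\<psi> u') + c/2 * t" by simp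
      define k where "k u = f (\<psi> (u + t *\<^sub>R w)) - f (\<psi> u) + c/2 * t" for u
      have "isCont k u'"
        unfolding k_def using isCont_\<psi>[OF inV[of u' t]] isCont_\<psi>[OF inV[of u' 0]] u' t r(1)
        by (intro continuous_intros continuous_infdist isCont_o2[of _ "\<lambda>u. u + t *\<^sub>R w" \<psi>]) auto
      moreover have "0 < k u'" using pos by (simp add: k_def)
      ultimately obtain \<rho> where \<rho>: "0 < \<rho>" "\<And>u''. dist u'' u' < \<rho> \<Longrightarrow> dist (k u'') (k u') < k u'"
        unfolding continuous_at_eps_delta by metis
      have k: "0 < k u''" if "dist u'' u' < \<rho>" for u''
        using \<rho>(2)[OF that] unfolding dist_real_def by linarith
      have dense: "u' \<in> V" "u' \<in> L" "0 < f (\<psi> u')" "0 < min \<rho> (r - dist u' u)"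
        using inV[of u' 0] u' r fm[of u'] \<open>0 < m\<close> \<rho>(1) by (auto simp: dist_commute)
      obtain u'' g y where u'': "u'' \<in> L" "dist u'' u' < min \<rho> (r - dist u' u)"
        and "has_gradient_on X f (\<psi> u'') g" "y \<in> Y" "f (\<psi> u'') = norm (\<psi> u'' - y)"
        "\<And>v. v \<in> tangent_space X (\<psi> u'') \<Longrightarrow> g \<bullet> v = sgn (\<psi> u'' - y) \<bullet> v"
        by (rule gradient_dense[OF dense]) (rule that)
      moreover have "u'' \<in> ball u r"
        using u''(2) dist_triangle[of u u'' u'] by (simp add: dist_commute)
      ultimately have "f (\<psi> (u'' + t *\<^sub>R w)) \<le> f (\<psi> u'') - c/2 * t"
        using t by (intro smooth_case)
      then show False using k[of u''] u''(2) by (simp add: k_def)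
    qed
    then show ?thesis using r(1) by blast
  qed
  then show ?thesis by (rule that[OF w(1) half_gt_zero[OF a(2)] \<delta>])
qed

end

section \<open>Level-parametrised descent\<close>

text \<open>The hypothesis looks only backwards and only from times with \<open>k\<close> positive,
  so positivity must be propagated as well. The line \<open>k 0 / 2 + c / 2 * t\<close> is a
  barrier, strictly below \<open>k\<close> at 0: at the first time \<open>k\<close> is not above it,
  a step back would show an earlier one.\<close>

lemma local_growth_imp_growth:
  fixes k :: "real \<Rightarrow> real"
  assumes cont: "continuous_on {0..T} k" and "0 < k 0" "0 \<le> T" "0 < c"
    and grow: "\<And>t. t \<in> {0..T} \<Longrightarrow> 0 < k t \<Longrightarrow> \<exists>r>0. \<forall>s\<in>{0..r}. s \<le> t \<longrightarrow> k (t - s) \<le> k t - c * s"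
  shows "c / 2 * T \<le> k T"
proof (rule ccontr)
  assume "\<not> c / 2 * T \<le> k T"
  define Z where "Z = {t\<in>{0..T}. k t \<le> k 0 / 2 + c / 2 * t}"
  have "closed Z"
    unfolding Z_def by (intro continuous_on_closed_Collect_le cont continuous_intros closed_atLeastAtMost)
  moreover have "bounded Z" by (rule bounded_subset[OF bounded_closed_interval[of 0 T]]) (auto simp: Z_def)
  moreover have "T \<in> Z" using assms(2,3) \<open>\<not> _\<close> by (simp add: Z_def)
  ultimately obtain t where t: "t \<in> Z" and tmin: "\<And>s. s \<in> Z \<Longrightarrow> t \<le> s"
    using compact_attains_inf[of Z] by (metis compact_eq_bounded_closed empty_iff)
  have tT: "t \<in> {0..T}" "k t \<le> k 0 / 2 + c / 2 * t" using t by (auto simp: Z_def)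
  have "t \<noteq> 0" using tT(2) assms(2) by auto
  then have "0 < t" using tT(1) by simp
  \<comment> \<open>Otherwise \<open>k\<close> takes the value \<open>k 0 / 2\<close> on the way
    down, and is then already not above the barrier.\<close>
  have "0 < k t"
  proof (rule ccontr)
    assume "\<not> 0 < k t"
    then have "\<exists>s\<ge>0. s \<le> t \<and> k s = k 0 / 2"
      using assms(2) tT(1) by (intro IVT2' continuous_on_subset[OF cont]) auto
    then obtain s where s: "0 \<le> s" "s \<le> t" "k s = k 0 / 2" by blast
    have "0 \<le> c / 2 * s" using s(1) assms(4) by simp
    then have "k s \<le> k 0 / 2 + c / 2 * s" using s(3) by linarith
    then have "s \<in> Z" using s tT(1) unfolding Z_def by simp
    then have "s = t" using tmin s by force
    then show False using s \<open>\<not> 0 < k t\<close> assms(2) by simp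
  qed
  then obtain r where r: "0 < r" "\<And>s. s \<in> {0..r} \<Longrightarrow> s \<le> t \<Longrightarrow> k (t - s) \<le> k t - c * s"
    using grow[OF tT(1)] by blast
  define s where "s = min r t"
  have s: "0 < s" "s \<le> r" "s \<le> t" using r(1) \<open>0 < t\<close> by (auto simp: s_def)
  have "k (t - s) \<le> k t - c * s" using r(2)[of s] s by simp
  also have "\<dots> \<le> k 0 / 2 + c / 2 * t - c / 2 * s"
    using tT(2) mult_pos_pos[OF assms(4) s(1)] by linarith
  finally have "t - s \<in> Z" using s tT(1) by (simp add: Z_def algebra_simps diff_divide_distrib)
  then show False using tmin[of "t - s"] s(1) by simp
qed

context dist_slice_chart
begin

lemma zero_gradient:
  assumes u: "u \<in> V" "u \<in> L" and "0 < \<eta>" and zero: "\<And>u'. u' \<in> ball u \<eta> \<Longrightarrow> u' \<in> L \<Longrightarrow> f (\<psi> u') = 0"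
  shows "has_gradient_on X f (\<psi> u) 0"
proof -
  obtain r where r: "0 < r" "\<And>x. x \<in> ball (\<psi> u) r \<Longrightarrow> x \<in> U \<and> \<phi> x \<in> ball u \<eta>"
    using chart_ball[OF u(1) assms(3)] by blast
  have "f x = 0" if "x \<in> X" "dist x (\<psi> u) < r" for x
    using r(2)[of x] zero[of "\<phi> x"] that \<phi>_in_L[of x] \<psi>_\<phi>[of x] by (simp add: dist_commute)
  then have "(f has_derivative (\<lambda>h. 0)) (at (\<psi> u) within X)"
    using r(1) \<psi>_in_X[OF u]
    by (intro has_derivative_transform_within[OF has_derivative_const[of 0]]) auto
  then show ?thesis
    using subspace_0[OF subspace_tangent_space[OF u]] \<psi>_in_X[OF u] by (simp add: has_gradient_on_def)
qed

text \<open>At a point of \<open>Y\<close> the distance vanishes on open sets arbitrarily close by, which yields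
  zero gradients, or it is positive on a dense set, from where it would have to grow at a definite
  rate along the ascent direction up to the given point.\<close>

lemma noncritical_imp_positive:
  assumes u0: "u0 \<in> V" "u0 \<in> L" and nc: "0 \<notin> clarke_subdifferential X f (\<psi> u0)"
  shows "0 < f (\<psi> u0)"
proof (rule ccontr)
  assume "\<not> 0 < f (\<psi> u0)"
  then have f0: "f (\<psi> u0) = 0" using infdist_nonneg[of "\<psi> u0" Y] by simp
  obtain w c \<delta> where w: "w \<in> L" "0 < c" "0 < \<delta>" "ball u0 \<delta> \<subseteq> V"
    and desc: "\<And>u. u \<in> ball u0 \<delta> \<Longrightarrow> u \<in> L \<Longrightarrow> 0 < f (\<psi> u) \<Longrightarrow>
      \<exists>r>0. \<forall>u'\<in>ball u r \<inter> L. \<forall>t\<in>{0..r}. f (\<psi> (u' + t *\<^sub>R w)) \<le> f (\<psi> u') - c * t"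
    by (rule local_descent[OF assms]) (rule that)
  have "(\<psi> u0, 0) \<notin> closure (gradient_graph X f)"
    using nc by (auto simp: clarke_subdifferential_eq_closure intro: hull_inc)
  then obtain e where e: "0 < e" "\<And>z. z \<in> gradient_graph X f \<Longrightarrow> e \<le> dist z (\<psi> u0, 0)"
    by (auto simp: closure_approachable not_less)
  obtain d where d: "0 < d" "\<And>u. dist u u0 < d \<Longrightarrow> dist (\<psi> u) (\<psi> u0) < e"
    using isCont_\<psi>[OF u0(1)] e(1) unfolding continuous_at_eps_delta by metis
  define \<rho> where "\<rho> = min d \<delta>"
  have \<rho>: "0 < \<rho>" "\<rho> \<le> d" "\<rho> \<le> \<delta>" using d(1) w(3) by (auto simp: \<rho>_def)
  \<comment> \<open>If \<open>f\<close> vanished near \<open>u\<close>, then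
    \<open>(\<psi> u, 0)\<close> would belong to the gradient graph, at distance less than
    \<open>e\<close> from \<open>(\<psi> u0, 0)\<close>.\<close>
  have dense: "\<exists>u'\<in>ball u \<eta> \<inter> L. 0 < f (\<psi> u')" if "u \<in> ball u0 \<rho>" "u \<in> L" "0 < \<eta>" for u \<eta>
  proof (rule ccontr)
    assume "\<not> ?thesis"
    then have "f (\<psi> u') = 0" if "u' \<in> ball u \<eta>" "u' \<in> L" for u'
      using that infdist_nonneg[of "\<psi> u'" Y] by force
    moreover have "u \<in> V" using that(1) \<rho>(3) w(4) by auto
    ultimately have "has_gradient_on X f (\<psi> u) 0" using that(2,3) by (intro zero_gradient) auto
    then have "e \<le> dist (\<psi> u, 0::'a) (\<psi> u0, 0)" using e(2)[of "(\<psi> u, 0)"] by (simp add: gradient_graph_def)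
    then show False using d(2)[of u] that(1) \<rho>(2) by (simp add: dist_Pair_Pair dist_commute)
  qed
  \<comment> \<open>Puts \<open>u0 + T *\<^sub>R w\<close> within \<open>\<rho> / 2\<close> of
    \<open>u0\<close>, leaving another \<open>\<rho> / 2\<close> for the choice of
    \<open>p\<close>.\<close>
  define T where "T = \<rho> / 2 / (1 + norm w)"
  have w1: "0 < 1 + norm w" by (simp add: add_pos_nonneg)
  have T: "0 < T" "T * norm w < \<rho> / 2"
  proof -
    show "0 < T" using \<rho>(1) w1 by (simp add: T_def)
    have "T * (1 + norm w) = \<rho> / 2"
    by (rule nonzero_eq_divide_eq[THEN iffD1, OF _ T_def]) (use w1 in simp)
    then show "T * norm w < \<rho> / 2" using \<open>0 < T\<close> by (simp add: distrib_left)
  qed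
  have "0 < c / 2 * T" using w(2) T(1) by simp
  then obtain d' where d': "0 < d'" "\<And>u. dist u u0 < d' \<Longrightarrow> dist (\<psi> u) (\<psi> u0) < c / 2 * T"
    using isCont_\<psi>[OF u0(1)] unfolding continuous_at_eps_delta by metis
  have LT: "u0 + T *\<^sub>R w \<in> L" using u0(2) w(1) subspaceL by (simp add: subspace_add subspace_scale)
  \<comment> \<open>The start is displaced along \<open>w\<close> so that the path against
    \<open>w\<close>, which goes uphill, ends close to \<open>u0\<close>. There \<open>f\<close> is
    below \<open>c / 2 * T\<close> by continuity, yet the growth along the path forces at least that
    value.\<close>
  have "\<exists>u'\<in>ball (u0 + T *\<^sub>R w) (min d' (\<rho>/2)) \<inter> L. 0 < f (\<psi> u')"
    using T \<rho>(1) d'(1) LT by (intro dense) (auto simp: dist_norm)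
  then obtain p where p: "dist p (u0 + T *\<^sub>R w) < d'" "dist p (u0 + T *\<^sub>R w) < \<rho> / 2" "p \<in> L" "0 < f (\<psi> p)"
    by (auto simp: dist_commute)
  have path: "p - t *\<^sub>R w \<in> ball u0 \<delta>" "p - t *\<^sub>R w \<in> L" if "t \<in> {0..T}" for t
  proof -
    have "p - t *\<^sub>R w - u0 = (p - (u0 + T *\<^sub>R w)) + (T - t) *\<^sub>R w" by (simp add: algebra_simps)
    then have "dist (p - t *\<^sub>R w) u0 \<le> dist p (u0 + T *\<^sub>R w) + \<bar>T - t\<bar> * norm w"
      by (metis dist_norm norm_scaleR norm_triangle_ineq)
    also have "\<bar>T - t\<bar> * norm w \<le> T * norm w" using that by (intro mult_right_mono) auto
    finally show "p - t *\<^sub>R w \<in> ball u0 \<delta>" using p(2) T(2) \<rho>(3) by (simp add: dist_commute)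
    show "p - t *\<^sub>R w \<in> L" using p(3) w(1) subspaceL by (simp add: subspace_diff subspace_scale)
  qed
  have "c / 2 * T \<le> f (\<psi> (p - T *\<^sub>R w))"
  proof (rule local_growth_imp_growth[where k = "\<lambda>t. f (\<psi> (p - t *\<^sub>R w))"])
    have "continuous_on {0..T} (\<lambda>t. \<psi> (p - t *\<^sub>R w))"
      using path(1) w(4) by (intro continuous_on_compose2[OF continuous_\<psi>] continuous_intros) auto
    then show "continuous_on {0..T} (\<lambda>t. f (\<psi> (p - t *\<^sub>R w)))" by (rule continuous_on_infdist)
    fix t assume t: "t \<in> {0..T}" "0 < f (\<psi> (p - t *\<^sub>R w))"
    then obtain r where r: "0 < r" "\<And>u' s. u' \<in> ball (p - t *\<^sub>R w) r \<inter> L \<Longrightarrow> s \<in> {0..r} \<Longrightarrow>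
        f (\<psi> (u' + s *\<^sub>R w)) \<le> f (\<psi> u') - c * s"
      using desc[OF path[OF t(1)]] by blast
    have "f (\<psi> (p - (t - s) *\<^sub>R w)) \<le> f (\<psi> (p - t *\<^sub>R w)) - c * s" if "s \<in> {0..r}" for s
      using r(2)[of "p - t *\<^sub>R w" s] that r(1) path(2)[OF t(1)] by (simp add: algebra_simps)
    then show "\<exists>r>0. \<forall>s\<in>{0..r}. s \<le> t \<longrightarrow> f (\<psi> (p - (t - s) *\<^sub>R w)) \<le> f (\<psi> (p - t *\<^sub>R w)) - c * s"
      using r(1) by blast
  qed (use p T w in auto)
  moreover have "dist (p - T *\<^sub>R w) u0 < d'" using p(1) by (simp add: dist_norm algebra_simps)
  then have "f (\<psi> (p - T *\<^sub>R w)) < c / 2 * T"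
    using d'(2) abs_le_D1[OF f_lipschitz[of "\<psi> (p - T *\<^sub>R w)" "\<psi> u0"]] f0 by fastforce
  ultimately show False by simp
qed

text \<open>Inverting the strictly decreasing function \<open>t \<mapsto> f (\<psi> (u + t *\<^sub>R w))\<close> turns \<open>f\<close>
  itself into the time parameter.\<close>

lemma local_level_descent:
  assumes u0: "u0 \<in> V" "u0 \<in> L" and nc: "0 \<notin> clarke_subdifferential X f (\<psi> u0)"
  shows "\<exists>r>0. \<exists>e>0. \<exists>P. continuous_on ((ball (\<psi> u0) r \<inter> X) \<times> {0..e}) P \<and>
    (\<forall>z\<in>ball (\<psi> u0) r \<inter> X. P (z, 0) = z \<and> (\<forall>s\<in>{0..e}. P (z, s) \<in> X \<and> f (P (z, s)) = f z - s))"
proof -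
  obtain w c \<delta> where w: "w \<in> L" "0 < c" "0 < \<delta>" "ball u0 \<delta> \<subseteq> V"
    and desc: "\<And>u. u \<in> ball u0 \<delta> \<Longrightarrow> u \<in> L \<Longrightarrow> 0 < f (\<psi> u) \<Longrightarrow>
      \<exists>r>0. \<forall>u'\<in>ball u r \<inter> L. \<forall>t\<in>{0..r}. f (\<psi> (u' + t *\<^sub>R w)) \<le> f (\<psi> u') - c * t"
    by (rule local_descent[OF assms]) (rule that)
  obtain r where r: "0 < r" and down: "\<And>u' t. u' \<in> ball u0 r \<inter> L \<Longrightarrow> t \<in> {0..r} \<Longrightarrow>
      f (\<psi> (u' + t *\<^sub>R w)) \<le> f (\<psi> u') - c * t"
    using desc[of u0] w(3) u0(2) noncritical_imp_positive[OF assms] by auto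
  define \<rho> where "\<rho> = min r \<delta>"
  have \<rho>: "0 < \<rho>" "\<rho> \<le> r" "\<rho> \<le> \<delta>" using r w(3) by (auto simp: \<rho>_def)
  \<comment> \<open>Lines of this duration starting in \<open>?B\<close> stay in
    \<open>ball u0 \<rho>\<close>, where both the chart and the estimate \<open>down\<close> are
    available.\<close>
  define \<tau> where "\<tau> = \<rho> / 2 / (1 + norm w)"
  have w1: "0 < 1 + norm w" by (simp add: add_pos_nonneg)
  have "0 < \<tau>" using \<rho>(1) w1 by (simp add: \<tau>_def)
  have "\<tau> * (1 + norm w) = \<rho> / 2"
    by (rule nonzero_eq_divide_eq[THEN iffD1, OF _ \<tau>_def]) (use w1 in simp)
  then have \<tau>: "\<tau> + \<tau> * norm w = \<rho> / 2" by (simp add: distrib_left)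
  have "0 \<le> \<tau> * norm w" using \<open>0 < \<tau>\<close> by simp
  then have "\<tau> \<le> r" using \<tau> \<rho> by linarith
  let ?B = "ball u0 (\<rho>/2) \<inter> L"
  define h where "h u t = f (\<psi> (u + t *\<^sub>R w))" for u t
  have line: "u + t *\<^sub>R w \<in> ball u0 \<rho> \<inter> L" if "u \<in> ?B" "t \<in> {0..\<tau>}" for u t
  proof -
    have "dist u0 (u + t *\<^sub>R w) \<le> dist u0 u + norm (t *\<^sub>R w)"
      using dist_triangle[of u0 "u + t *\<^sub>R w" u] by (simp add: dist_norm)
    also have "norm (t *\<^sub>R w) \<le> \<tau> * norm w" using that(2) by (simp add: mult_right_mono)
    finally have "dist u0 (u + t *\<^sub>R w) < \<rho>" using that(1) \<tau> \<open>0 < \<tau>\<close> by simp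
    then show ?thesis using that(1) w(1) subspaceL by (simp add: subspace_add subspace_scale)
  qed
  have lineV: "u + t *\<^sub>R w \<in> V" if "u \<in> ?B" "t \<in> {0..\<tau>}" for u t
    using line[OF that] \<rho>(3) w(4) by auto
  have h0: "h u 0 = f (\<psi> u)" for u by (simp add: h_def)
  have hdown: "h u t' \<le> h u t - c * (t' - t)" if "u \<in> ?B" "0 \<le> t" "t \<le> t'" "t' \<le> \<tau>" for u t t'
    using down[of "u + t *\<^sub>R w" "t' - t"] line[OF that(1), of t] that \<rho>(2) \<open>\<tau> \<le> r\<close>
    by (simp add: h_def algebra_simps)
  have hcont: "continuous_on (?B \<times> {0..\<tau>}) (\<lambda>z. h (fst z) (snd z))"
    unfolding h_def
    by (intro continuous_on_infdist continuous_on_compose2[OF continuous_\<psi>] continuous_intros)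
      (use lineV in force)
  \<comment> \<open>By \<open>hdown\<close> the total drop over \<open>{0..\<tau>}\<close> is at
    least \<open>c * \<tau>\<close>, so every smaller drop is attained.\<close>
  have ex: "\<exists>t. t \<in> {0..\<tau>} \<and> h u t = f (\<psi> u) - s" if "u \<in> ?B" "s \<in> {0..c * \<tau>}" for u s
  proof -
    have "continuous_on {0..\<tau>} (\<lambda>t. h (fst (u, t)) (snd (u, t)))"
      using that(1) by (intro continuous_on_compose2[OF hcont] continuous_intros) auto
    then have "\<exists>t\<ge>0. t \<le> \<tau> \<and> h u t = f (\<psi> u) - s"
      using hdown[OF that(1), of 0 \<tau>] that(2) \<open>0 < \<tau>\<close> by (intro IVT2') (auto simp: h0)
    then show ?thesis by auto
  qed
  have less: "h u t' < h u t" if "u \<in> ?B" "0 \<le> t" "t < t'" "t' \<le> \<tau>" for u t t'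
  proof -
    have "0 < c * (t' - t)" using w(2) that(3) by simp
    moreover have "h u t' \<le> h u t - c * (t' - t)" using that by (intro hdown) auto
    ultimately show ?thesis by linarith
  qed
  have inj: "t = t'" if "u \<in> ?B" "t \<in> {0..\<tau>}" "t' \<in> {0..\<tau>}" "h u t = h u t'" for u t t'
    using less[OF that(1), of t t'] less[OF that(1), of t' t] that(2-4) by (cases t t' rule: linorder_cases) auto
  define \<theta> where "\<theta> = (\<lambda>(u, s). SOME t. t \<in> {0..\<tau>} \<and> h u t = f (\<psi> u) - s)"
  have \<theta>: "\<theta> (u, s) \<in> {0..\<tau>}" "h u (\<theta> (u, s)) = f (\<psi> u) - s" if "u \<in> ?B" "s \<in> {0..c * \<tau>}" for u s
    using someI_ex[OF ex[OF that]] by (auto simp: \<theta>_def)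
  let ?A = "?B \<times> {0..c * \<tau>}"
  have \<theta>A: "\<theta> \<in> ?A \<rightarrow> {0..\<tau>}" using \<theta>(1) by auto
  \<comment> \<open>As \<open>\<theta>\<close> takes values in a compact interval, a closed graph
    suffices for continuity; by uniqueness of the time, the graph is the zero set of the continuous
    function \<open>?F\<close>.\<close>
  have \<theta>cont: "continuous_on ?A \<theta>"
    unfolding continuous_closed_graph_eq[OF compact_Icc \<theta>A]
  proof -
    let ?F = "\<lambda>z. h (fst (fst z)) (snd z) - f (\<psi> (fst (fst z))) + snd (fst z)"
    have "(\<lambda>x. (x, \<theta> x)) ` ?A = ?A \<times> {0..\<tau>} \<inter> ?F -` {0}"
    proof (intro set_eqI iffI)
      fix z assume "z \<in> (\<lambda>x. (x, \<theta> x)) ` ?A"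
      then obtain u s where z: "z = ((u, s), \<theta> (u, s))" and us: "u \<in> ?B" "s \<in> {0..c * \<tau>}" by blast
      show "z \<in> ?A \<times> {0..\<tau>} \<inter> ?F -` {0}" using \<theta>[OF us] us unfolding z by simp
    next
      fix z assume z: "z \<in> ?A \<times> {0..\<tau>} \<inter> ?F -` {0}"
      then obtain u s t where zz: "z = ((u, s), t)" and us: "u \<in> ?B" "s \<in> {0..c * \<tau>}" "t \<in> {0..\<tau>}" by auto
      have "h u t = f (\<psi> u) - s" using z unfolding zz by simp
      then have "t = \<theta> (u, s)" using inj[OF us(1,3) \<theta>(1)[OF us(1,2)]] \<theta>(2)[OF us(1,2)] by simp
      then show "z \<in> (\<lambda>x. (x, \<theta> x)) ` ?A" using us unfolding zz by blast
    qed
    moreover have "continuous_on (?A \<times> {0..\<tau>}) ?F"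
    proof (intro continuous_intros continuous_on_infdist)
      show "continuous_on (?A \<times> {0..\<tau>}) (\<lambda>z. h (fst (fst z)) (snd z))"
        by (rule continuous_on_compose2[OF hcont, of _ "\<lambda>z. (fst (fst z), snd z)", simplified])
          (auto intro!: continuous_intros)
      show "continuous_on (?A \<times> {0..\<tau>}) (\<lambda>z. \<psi> (fst (fst z)))"
        using lineV[of _ 0] \<open>0 < \<tau>\<close>
        by (intro continuous_on_compose2[OF continuous_\<psi>] continuous_intros) auto
    qed
    ultimately show "closedin (top_of_set (?A \<times> {0..\<tau>})) ((\<lambda>x. (x, \<theta> x)) ` ?A)"
      by (simp only: continuous_closedin_preimage closed_singleton)
  qed
  obtain r' where r': "0 < r'" "\<And>x. x \<in> ball (\<psi> u0) r' \<Longrightarrow> x \<in> U \<and> \<phi> x \<in> ball u0 (\<rho>/2)"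
    by (rule chart_ball[OF u0(1) half_gt_zero[OF \<rho>(1)]]) (rule that)
  let ?N = "ball (\<psi> u0) r' \<inter> X"
  have NB: "\<phi> x \<in> ?B" "\<psi> (\<phi> x) = x" "x \<in> U" if "x \<in> ?N" for x
    using r'(2)[of x] that \<phi>_in_L[of x] \<psi>_\<phi>[of x] by auto
  define P where "P = (\<lambda>(x, s). \<psi> (\<phi> x + \<theta> (\<phi> x, s) *\<^sub>R w))"
  have "0 < c * \<tau>" using w(2) \<open>0 < \<tau>\<close> by simp
  show ?thesis
  proof (rule exI[of _ r'], rule conjI[OF r'(1)], rule exI[of _ "c * \<tau>"],
      rule conjI[OF \<open>0 < c * \<tau>\<close>], rule exI[of _ P], intro conjI ballI)
    have \<phi>c: "continuous_on (?N \<times> {0..c * \<tau>}) (\<lambda>z. \<phi> (fst z))"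
      using NB by (intro continuous_on_compose2[OF continuous_\<phi>] continuous_intros) auto
    then have "continuous_on (?N \<times> {0..c * \<tau>}) (\<lambda>z. \<theta> (\<phi> (fst z), snd z))"
      using NB(1) by (intro continuous_on_compose2[OF \<theta>cont] continuous_intros) auto
    then have "continuous_on (?N \<times> {0..c * \<tau>}) (\<lambda>z. \<psi> (\<phi> (fst z) + \<theta> (\<phi> (fst z), snd z) *\<^sub>R w))"
      using \<phi>c lineV[OF NB(1) \<theta>(1)[OF NB(1)]]
      by (intro continuous_on_compose2[OF continuous_\<psi>] continuous_intros) auto
    then show "continuous_on (?N \<times> {0..c * \<tau>}) P" by (simp add: P_def split_beta)
  next
    fix x assume x: "x \<in> ?N"
    have "0 \<in> {0..c * \<tau>}" "0 \<in> {0..\<tau>}" using \<open>0 < c * \<tau>\<close> \<open>0 < \<tau>\<close> by simp_all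
    note \<theta>0 = \<theta>[OF NB(1)[OF x] this(1)]
    have "h (\<phi> x) (\<theta> (\<phi> x, 0)) = h (\<phi> x) 0" by (simp only: \<theta>0(2) h0 diff_zero)
    then have "\<theta> (\<phi> x, 0) = 0" by (rule inj[OF NB(1)[OF x] \<theta>0(1) \<open>0 \<in> {0..\<tau>}\<close>])
    then show "P (x, 0) = x" using NB(2)[OF x] by (simp add: P_def)
    fix s assume s: "s \<in> {0..c * \<tau>}"
    note \<theta>s = \<theta>[OF NB(1)[OF x] s]
    show "P (x, s) \<in> X"
      using line[OF NB(1)[OF x] \<theta>s(1)] lineV[OF NB(1)[OF x] \<theta>s(1)] by (simp add: P_def \<psi>_in_X)
    show "f (P (x, s)) = f x - s" using \<theta>s(2) NB(2)[OF x] by (simp add: P_def h_def)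
  qed
qed

end

text \<open>Compactness of the slab supplies the finite cover and with it a uniform height of
  descent; it holds for instance whenever \<open>X\<close> is compact. With \<open>Y\<close>
  nonempty, \<open>infdist\<close> is the true distance rather than its default value 0.\<close>

theorem proposition1p2p2:
  fixes X Y :: "(real ^ 'n) set" and a b :: real
  assumes "smooth_submanifold X"
    and "closed Y" and "Y \<noteq> {}" and "definable Y"
    and "a \<le> b"
    and "compact {x\<in>X. a \<le> infdist x Y \<and> infdist x Y \<le> b}"
    and "\<forall>c\<in>{a..b}. \<not> critical_value X (\<lambda>x. infdist x Y) c"
  shows "deformation_retract_of (sublevel_dist X Y a) (sublevel_dist X Y b)"
  unfolding sublevel_dist_def
proof (rule deformation_retract_of_sublevel)
  show "continuous_on X (\<lambda>x. infdist x Y)" by (intro continuous_intros)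
  fix p assume p: "p \<in> X" "a \<le> infdist p Y" "infdist p Y \<le> b"
  then have nc: "0 \<notin> clarke_subdifferential X (\<lambda>x. infdist x Y) p"
    using assms(7) by (auto simp: critical_value_def critical_point_def)
  obtain U V \<phi> \<psi> L where p: "p \<in> U" and chart: "slice_chart X U V L \<phi> \<psi>"
    using assms(1) p(1) unfolding smooth_submanifold_def smooth_submanifold_dim_def slice_chart_def by metis
  interpret dist_slice_chart X U V L \<phi> \<psi> Y
    using chart assms(2,3) by (simp add: dist_slice_chart_def dist_slice_chart_axioms_def)
  show "\<exists>r>0. \<exists>e>0. \<exists>P. continuous_on ((ball p r \<inter> X) \<times> {0..e}) P \<and>
        (\<forall>z\<in>ball p r \<inter> X. P (z, 0) = z \<and>
          (\<forall>s\<in>{0..e}. P (z, s) \<in> X \<and> infdist (P (z, s)) Y = infdist z Y - s))"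
    using local_level_descent[of "\<phi> p"] \<psi>_\<phi>[OF p] \<phi>_in_L[OF p] \<open>p \<in> X\<close> nc by simp
qed (use assms in auto)

end
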